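(* Let $G_0:\mathbb{R}\to(0,1)$ be a continuous strictly increasing bijection with density $g_0=G_0'$, and for $\theta=(\mu,\sigma)\in\mathbb{R}\times(0,\infty)$ let $G_\theta(x)=G_0((x-\mu)/\sigma)$. Let $X,X_1,X_2,\ldots$ be i.i.d. real random variables with law $P$, and let $\widehat\theta_n=(\widehat\mu_n,\widehat\sigma_n)$ be estimators (functions of $X_1,\ldots,X_n$) with probability limit $\theta_0\in\mathbb{R}\times(0,\infty)$. Put $$m(\theta)=\mathbb{E}[G_\theta(X)],\quad b(\theta)=G_\theta^{-1}(m(\theta)),\quad b_0=b(\theta_0),\quad \widehat m_n=\frac1n\sum_{i=1}^nG_{\widehat\theta_n}(X_i),\quad \widehat b_n^{\mathrm{ad}}=G_{\widehat\theta_n}^{-1}(\widehat m_n).$$ Assume: (i) $\sqrt n(\widehat\theta_n-\theta_0)=\frac1{\sqrt n}\sum_{i=1}^n\psi_\theta(X_i)+o_{\mathbb{P}}(1)$, where $\psi_\theta:\mathbb{R}\to\mathbb{R}^2$ satisfies $\mathbb{E}[\psi_\theta(X)]=0$ and $\mathbb{E}\|\psi_\theta(X)\|^2<\infty$; (ii) the class $\{G_\theta:\theta\in\Theta_0\}$ is $P$-Donsker for a neighbourhood $\Theta_0$ of $\theta_0$, and $\theta\mapsto G_\theta$ is differentiable at $\theta_0$ in $L^2(P)$; (iii) $m$ is differentiable at $\theta_0$, $G_{\theta_0}$ is differentiable at $b_0$, and $G'_{\theta_0}(b_0)>0$. Then $$\sqrt n(\widehat b_n^{\mathrm{ad}}-b_0)=\frac1{\sqrt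 n}\sum_{i=1}^n\operatorname{IF}_{\mathrm{ad}}(X_i)+o_{\mathbb{P}}(1),$$ where $$\operatorname{IF}_{\mathrm{ad}}(x)=\frac{G_{\theta_0}(x)-m(\theta_0)+\Delta^\top\psi_\theta(x)}{G'_{\theta_0}(b_0)},\qquad \Delta=\nabla_\theta m(\theta_0)-\nabla_\theta G_\theta(b_0)\big|_{\theta=\theta_0}.$$ Consequently $$\sqrt n(\widehat b_n^{\mathrm{ad}}-b_0)\rightsquigarrow\mathcal N(0,\tau_{\mathrm{ad}}^2),\qquad \tau_{\mathrm{ad}}^2=\mathbb{E}[\operatorname{IF}_{\mathrm{ad}}(X)^2].$$
   Context: $G'_\theta(x)$ denotes the derivative in $x$; $\nabla_\theta G_\theta(b_0)|_{\theta=\theta_0}$ is the gradient in $\theta$ at $\theta_0$ of $\theta\mapsto G_\theta(b_0)$ with $b_0$ held fixed. Differentiability in $L^2(P)$ at $\theta_0$ means there is $\dot G\in L^2(P;\mathbb{R}^2)$ with $\|G_\theta-G_{\theta_0}-(\theta-\theta_0)^\top\dot G\|_{L^2(P)}=o(\|\theta-\theta_0\|)$ as $\theta\to\theta_0$. The subscript in $\psi_\theta$ is only a name (the influence function of the estimator of $\theta$). $\mathcal N(0,0)$ is the point mass at $0$. *)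

theory Defs
  imports "HOL-Probability.Probability" "HOL-Library.Landau_Symbols"
begin

subsection \<open>Convergence in probability and normal laws\<close>

definition conv_in_prob ::
  "'w measure \<Rightarrow> (nat \<Rightarrow> 'w \<Rightarrow> 'b :: {metric_space, second_countable_topology}) \<Rightarrow> 'b \<Rightarrow> bool"
  where "conv_in_prob M Z c \<longleftrightarrow>
    (\<forall>n. Z n \<in> borel_measurable M) \<and>
    (\<forall>\<epsilon>>0. (\<lambda>n. measure M {\<omega> \<in> space M. dist (Z n \<omega>) c > \<epsilon>}) \<longlonglongrightarrow> 0)"

abbreviation oP1 ::
  "'w measure \<Rightarrow> (nat \<Rightarrow> 'w \<Rightarrow> 'b :: {real_normed_vector, second_countable_topology}) \<Rightarrow> bool"
  where "oP1 M Z \<equiv> conv_in_prob M Z 0"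

text \<open>The second parameter is the variance, and \<open>normal_law a 0\<close> is the point mass at \<open>a\<close>.\<close>

definition normal_law :: "real \<Rightarrow> real \<Rightarrow> real measure"
  where "normal_law a v =
    (if v = 0 then return borel a else density lborel (\<lambda>x. ennreal (normal_density a (sqrt v) x)))"

subsection \<open>Donsker classes\<close>

text \<open>The Banach space of bounded real functions on \<open>F\<close> with the supremum metric.
  Its points are extensional, that is, \<open>undefined\<close> off \<open>F\<close>.\<close>

definition ell_infinity :: "'b set \<Rightarrow> ('b \<Rightarrow> real) metric"
  where "ell_infinity F = funspace F euclidean_metric"

lemma mspace_ell_infinity: "mspace (ell_infinity F) = {z \<in> extensional F. bounded (z ` F)}"
  by (auto simp: ell_infinity_def Met_TC.fspace_def)

lemma mdist_ell_infinity:
  assumes "F \<noteq> {}" "y \<in> mspace (ell_infinity F)" "z \<in> mspace (ell_infinity F)"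
  shows "mdist (ell_infinity F) y z = (SUP f\<in>F. \<bar>y f - z f\<bar>)"
  using assms unfolding ell_infinity_def by (simp add: dist_real_def Met_TC.fdist_def)

definition borel_sigma :: "'b topology \<Rightarrow> 'b set set"
  where "borel_sigma T = sigma_sets (topspace T) {U. openin T U}"

definition tight_borel_prob :: "'b topology \<Rightarrow> 'b measure \<Rightarrow> bool"
  where "tight_borel_prob T L \<longleftrightarrow>
    prob_space L \<and> space L = topspace T \<and> sets L = borel_sigma T \<and>
    (\<forall>\<epsilon>>0. \<exists>K. compactin T K \<and> K \<in> sets L \<and> measure L K \<ge> 1 - \<epsilon>)"

text \<open>The definition of outer expectation is meant for bounded, possibly non-measurable \<open>Z\<close>,
  for which the infimum ranges over a nonempty set that is bounded below.\<close>

definition outer_expectation :: "'w measure \<Rightarrow> ('w \<Rightarrow> real) \<Rightarrow> real"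
  where "outer_expectation M Z =
    Inf {(\<integral>\<omega>. U \<omega> \<partial>M) | U. integrable M U \<and> (\<forall>\<omega>\<in>space M. Z \<omega> \<le> U \<omega>)}"

text \<open>Weak convergence in the sense of Hoffmann-Jorgensen: the maps \<open>Z n\<close> need not be
  measurable for the Borel sets of the metric space.\<close>

definition weak_conv_HJ :: "'w measure \<Rightarrow> (nat \<Rightarrow> 'w \<Rightarrow> 'b) \<Rightarrow> 'b metric \<Rightarrow> 'b measure \<Rightarrow> bool"
  where "weak_conv_HJ M Z d L \<longleftrightarrow>
    (\<forall>h. continuous_map (mtopology_of d) euclideanreal h \<and> bounded (h ` mspace d) \<longrightarrow>
      (\<lambda>n. outer_expectation M (\<lambda>\<omega>. h (Z n \<omega>))) \<longlonglongrightarrow> (\<integral>z. h z \<partial>L))"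

definition empirical_process :: "'a measure \<Rightarrow> nat \<Rightarrow> (nat \<Rightarrow> 'a) \<Rightarrow> ('a \<Rightarrow> real) \<Rightarrow> real"
  where "empirical_process P n x f =
    sqrt (real n) * ((\<Sum>i<n. f (x i)) / real n - (\<integral>y. f y \<partial>P))"

text \<open>The observations are the coordinate projections on the infinite product of \<open>P\<close>.  The third
  condition makes the sample paths of the empirical process bounded on \<open>F\<close>.\<close>

definition donsker :: "'a measure \<Rightarrow> ('a \<Rightarrow> real) set \<Rightarrow> bool"
  where "donsker P F \<longleftrightarrow>
    (\<forall>f\<in>F. f \<in> borel_measurable P) \<and>
    (\<forall>f\<in>F. integrable P f) \<and>
    (\<forall>x\<in>space P. bounded ((\<lambda>f. f x - (\<integral>y. f y \<partial>P)) ` F)) \<and>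
    (\<exists>L. tight_borel_prob (mtopology_of (ell_infinity F)) L \<and>
      weak_conv_HJ (PiM (UNIV :: nat set) (\<lambda>_. P))
        (\<lambda>n x. restrict (empirical_process P n x) F) (ell_infinity F) L)"

subsection \<open>Differentiability\<close>

definition L2_norm :: "'a measure \<Rightarrow> ('a \<Rightarrow> real) \<Rightarrow> real"
  where "L2_norm P f = sqrt (\<integral>x. (f x)\<^sup>2 \<partial>P)"

definition L2_differentiable ::
  "'a measure \<Rightarrow> ('t :: euclidean_space \<Rightarrow> 'a \<Rightarrow> real) \<Rightarrow> 't \<Rightarrow> bool"
  where "L2_differentiable P G \<theta>\<^sub>0 \<longleftrightarrow>
    (\<exists>D. D \<in> borel_measurable P \<and> integrable P (\<lambda>x. (norm (D x))\<^sup>2) \<and>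
      (\<lambda>\<theta>. L2_norm P (\<lambda>x. G \<theta> x - G \<theta>\<^sub>0 x - (\<theta> - \<theta>\<^sub>0) \<bullet> D x)) \<in> o[at \<theta>\<^sub>0](\<lambda>\<theta>. norm (\<theta> - \<theta>\<^sub>0)))"

definition gradient :: "('t :: euclidean_space \<Rightarrow> real) \<Rightarrow> 't \<Rightarrow> 't"
  where "gradient f \<theta> = (THE D. GDERIV f \<theta> :> D)"

subsection \<open>The location-scale family and the estimator\<close>

text \<open>A parameter is a pair \<open>(\<mu>, \<sigma>)\<close>; the parameter space is \<open>UNIV \<times> {0<..}\<close>.
  Outside it, where an estimator may fall with vanishing probability, the formulas below have
  no meaning beyond totality.\<close>

definition G_ls :: "(real \<Rightarrow> real) \<Rightarrow> real \<times> real \<Rightarrow> real \<Rightarrow> real"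
  where "G_ls G\<^sub>0 \<theta> x = G\<^sub>0 ((x - fst \<theta>) / snd \<theta>)"

definition m_ls :: "(real \<Rightarrow> real) \<Rightarrow> real measure \<Rightarrow> real \<times> real \<Rightarrow> real"
  where "m_ls G\<^sub>0 P \<theta> = (\<integral>x. G_ls G\<^sub>0 \<theta> x \<partial>P)"

definition b_ls :: "(real \<Rightarrow> real) \<Rightarrow> real measure \<Rightarrow> real \<times> real \<Rightarrow> real"
  where "b_ls G\<^sub>0 P \<theta> = inv (G_ls G\<^sub>0 \<theta>) (m_ls G\<^sub>0 P \<theta>)"

definition m_hat :: "(real \<Rightarrow> real) \<Rightarrow> nat \<Rightarrow> real \<times> real \<Rightarrow> (nat \<Rightarrow> real) \<Rightarrow> real"
  where "m_hat G\<^sub>0 n \<theta> x = (1 / real n) * (\<Sum>i<n. G_ls G\<^sub>0 \<theta> (x i))"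

definition b_ad :: "(real \<Rightarrow> real) \<Rightarrow> nat \<Rightarrow> real \<times> real \<Rightarrow> (nat \<Rightarrow> real) \<Rightarrow> real"
  where "b_ad G\<^sub>0 n \<theta> x = inv (G_ls G\<^sub>0 \<theta>) (m_hat G\<^sub>0 n \<theta> x)"

definition Delta :: "(real \<Rightarrow> real) \<Rightarrow> real measure \<Rightarrow> real \<times> real \<Rightarrow> real \<times> real"
  where "Delta G\<^sub>0 P \<theta>\<^sub>0 =
    gradient (m_ls G\<^sub>0 P) \<theta>\<^sub>0 - gradient (\<lambda>\<theta>. G_ls G\<^sub>0 \<theta> (b_ls G\<^sub>0 P \<theta>\<^sub>0)) \<theta>\<^sub>0"

definition IF_ad ::
  "(real \<Rightarrow> real) \<Rightarrow> real measure \<Rightarrow> real \<times> real \<Rightarrow> (real \<Rightarrow> real \<times> real) \<Rightarrow> real \<Rightarrow> real"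
  where "IF_ad G\<^sub>0 P \<theta>\<^sub>0 \<psi> x =
    (G_ls G\<^sub>0 \<theta>\<^sub>0 x - m_ls G\<^sub>0 P \<theta>\<^sub>0 + Delta G\<^sub>0 P \<theta>\<^sub>0 \<bullet> \<psi> x) / deriv (G_ls G\<^sub>0 \<theta>\<^sub>0) (b_ls G\<^sub>0 P \<theta>\<^sub>0)"

end

theory Submission
  imports Defs
begin

text \<open>
  The estimator is \<open>q(\<theta>\<^sub>n, m\<^sub>n)\<close> with \<open>q(\<theta>, y) = \<mu> + \<sigma> G\<^sub>0\<^sup>-\<^sup>1(y)\<close>, so everything follows from the delta
  method for \<open>q\<close> and \<open>m\<close>, the central limit theorem and Slutsky's lemma, once the empirical process
  \<open>\<nu>\<^sub>n\<close> satisfies \<open>\<nu>\<^sub>n(G\<^sub>\<theta>) - \<nu>\<^sub>n(G\<^sub>\<theta>\<^sub>0) \<longrightarrow> 0\<close> in probability at the estimated \<open>\<theta>\<close>.  The expansion of the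
  estimator confines \<open>\<theta>\<close> to a ball of radius \<open>C / sqrt n\<close>, which finitely many boxes of side
  \<open>r / sqrt n\<close> cover, uniformly in \<open>n\<close>.  Since \<open>G\<^sub>\<theta>(x)\<close> is monotone in \<open>\<mu>\<close> and in \<open>\<sigma>\<close>, its oscillation
  over a box is dominated by its values at the four corners; by differentiability in \<open>L\<^sup>2(P)\<close> this
  envelope has \<open>P\<close>-mean of order \<open>r / sqrt n\<close>, and the finitely many remaining empirical processes
  have vanishing variance.
\<close>

subsection \<open>Convergence and boundedness in probability\<close>

text \<open>The second-moment bound for an empirical process needs a nonrandom function, whereas the
  estimate depends on the same observations; passing to box centres removes this dependence. Boxes
  refined with \<open>n\<close> would grow in number, so \<open>r\<close> stays fixed: the scaled
  mean of the envelope then does not vanish, but it is of order \<open>r\<close>, and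
  \<open>r\<close> is chosen from the target accuracy before \<open>n\<close> grows.
  Differentiability is available at \<open>\<theta>\<^sub>0\<close> alone, so two nearby parameters
  are compared by expanding both around \<open>\<theta>\<^sub>0\<close>; on the scale
  \<open>1 / sqrt n\<close> both remainders are negligible and a bound linear in the distance is
  left. It is a bound on first moments, which controls second moments because all functions involved
  are bounded. \<open>Delta\<close> is a difference of gradients because the estimated parameter
  acts twice: it shifts the mean through the gradient of \<open>m\<close>, and implicit
  differentiation of \<open>G_\<theta>(q) = y\<close> makes the quantile respond with minus the
  gradient of \<open>G_\<theta>\<close> at the fixed point, divided by the slope.\<close>

context prob_space
begin

text \<open>An outer-probability form of "fails with probability at most \<open>d\<close> for large
  \<open>n\<close>". The events \<open>A n\<close> only have to cover the failures, so
  \<open>Q n\<close> need not define a measurable set and can be weakened or combined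
  freely.\<close>

definition mostly :: "real \<Rightarrow> (nat \<Rightarrow> 'a \<Rightarrow> bool) \<Rightarrow> bool"
  where "mostly d Q \<longleftrightarrow>
    (\<exists>A. \<forall>\<^sub>F n in sequentially. A n \<in> events \<and> prob (A n) \<le> d \<and> (\<forall>\<omega>\<in>space M - A n. Q n \<omega>))"

lemma mostly_mono:
  assumes "mostly d Q" and "\<forall>\<^sub>F n in sequentially. \<forall>\<omega>\<in>space M. Q n \<omega> \<longrightarrow> R n \<omega>"
  shows "mostly d R"
proof -
  obtain A where "\<forall>\<^sub>F n in sequentially. A n \<in> events \<and> prob (A n) \<le> d \<and> (\<forall>\<omega>\<in>space M - A n. Q n \<omega>)"
    using assms(1) by (auto simp: mostly_def)
  then have "\<forall>\<^sub>F n in sequentially. A n \<in> events \<and> prob (A n) \<le> d \<and> (\<forall>\<omega>\<in>space M - A n. R n \<omega>)"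
    using assms(2) by eventually_elim auto
  then show ?thesis by (auto simp: mostly_def)
qed

lemma mostly_conj:
  assumes "mostly a Q" "mostly b R"
  shows "mostly (a + b) (\<lambda>n \<omega>. Q n \<omega> \<and> R n \<omega>)"
proof -
  obtain A B where
    A: "\<forall>\<^sub>F n in sequentially. A n \<in> events \<and> prob (A n) \<le> a \<and> (\<forall>\<omega>\<in>space M - A n. Q n \<omega>)" and
    B: "\<forall>\<^sub>F n in sequentially. B n \<in> events \<and> prob (B n) \<le> b \<and> (\<forall>\<omega>\<in>space M - B n. R n \<omega>)"
    using assms by (auto simp: mostly_def)
  have "\<forall>\<^sub>F n in sequentially. A n \<union> B n \<in> events \<and> prob (A n \<union> B n) \<le> a + b \<and>
      (\<forall>\<omega>\<in>space M - (A n \<union> B n). Q n \<omega> \<and> R n \<omega>)"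
    using A B
  proof eventually_elim
    case (elim n)
    then have "prob (A n \<union> B n) \<le> prob (A n) + prob (B n)"
      by (intro measure_Un_le) auto
    with elim show ?case by auto
  qed
  then show ?thesis unfolding mostly_def by (intro exI[of _ "\<lambda>n. A n \<union> B n"])
qed

lemma mostly_conj_half:
  "mostly (d / 2) Q \<Longrightarrow> mostly (d / 2) R \<Longrightarrow> mostly d (\<lambda>n \<omega>. Q n \<omega> \<and> R n \<omega>)" for d :: real
  using mostly_conj[of "d/2" Q "d/2" R] by simp

text \<open>Each insertion halves the budget, so the hypothesis is required for every positive
  \<open>d\<close> and the induction generalizes over it.\<close>

lemma mostly_ball_finite:
  assumes "finite E" and "\<And>c d. c \<in> E \<Longrightarrow> d > 0 \<Longrightarrow> mostly d (Q c)" and "d > 0"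
  shows "mostly d (\<lambda>n \<omega>. \<forall>c\<in>E. Q c n \<omega>)"
  using assms
proof (induction E arbitrary: d rule: finite_induct)
  case empty
  then show ?case by (auto simp: mostly_def intro!: exI[of _ "\<lambda>_. {}"])
next
  case (insert c E)
  from mostly_conj_half[OF insert.prems(1)[of c "d/2"] insert.IH[of "d/2"]] insert.prems
  show ?case by simp
qed

lemma mostlyI_tendsto_0:
  assumes "\<And>n. {\<omega> \<in> space M. \<not> Q n \<omega>} \<in> events"
    and "(\<lambda>n. prob {\<omega> \<in> space M. \<not> Q n \<omega>}) \<longlonglongrightarrow> 0" and "d > 0"
  shows "mostly d Q"
  using order_tendstoD(2)[OF assms(2,3)] assms(1) unfolding mostly_def
  by (intro exI[of _ "\<lambda>n. {\<omega> \<in> space M. \<not> Q n \<omega>}"]) (auto elim: eventually_mono)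

lemma oP1_iff_mostly:
  fixes Z :: "nat \<Rightarrow> 'a \<Rightarrow> 'b :: {real_normed_vector, second_countable_topology}"
  shows "oP1 M Z \<longleftrightarrow> (\<forall>n. Z n \<in> borel_measurable M) \<and>
    (\<forall>e>0. \<forall>d>0. mostly d (\<lambda>n \<omega>. norm (Z n \<omega>) \<le> e))" (is "?l \<longleftrightarrow> ?r")
proof
  assume l: ?l
  then have [measurable]: "\<And>n. Z n \<in> borel_measurable M" by (simp add: conv_in_prob_def)
  show ?r using l
    by (auto simp: conv_in_prob_def not_le intro!: mostlyI_tendsto_0)
next
  assume r: ?r
  then have [measurable]: "\<And>n. Z n \<in> borel_measurable M" by simp
  have "(\<lambda>n. prob {\<omega> \<in> space M. norm (Z n \<omega>) > e}) \<longlonglongrightarrow> 0" if "e > 0" for e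
  proof (rule LIMSEQ_I)
    fix r :: real assume "r > 0"
    then obtain A where A: "\<forall>\<^sub>F n in sequentially.
      A n \<in> events \<and> prob (A n) \<le> r/2 \<and> (\<forall>\<omega>\<in>space M - A n. norm (Z n \<omega>) \<le> e)"
      using r \<open>e > 0\<close> by (fastforce simp: mostly_def dest: spec[of _ "r/2"])
    have "\<forall>\<^sub>F n in sequentially. norm (prob {\<omega> \<in> space M. norm (Z n \<omega>) > e} - 0) < r"
      using A
    proof eventually_elim
      case (elim n)
      \<comment> \<open>Measurability of \<open>Z n\<close> makes the exact failure set an event, so
        it inherits the bound of its cover; \<open>r/2\<close> leaves room for the strict
        inequality.\<close>
      have "prob {\<omega> \<in> space M. norm (Z n \<omega>) > e} \<le> prob (A n)"
        using elim by (intro finite_measure_mono) (auto simp: not_le[symmetric])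
      with elim \<open>r > 0\<close> show ?case by simp
    qed
    then show "\<exists>no. \<forall>n\<ge>no. norm (prob {\<omega> \<in> space M. norm (Z n \<omega>) > e} - 0) < r"
      by (simp add: eventually_sequentially)
  qed
  then show ?l by (simp add: conv_in_prob_def)
qed

lemma oP1_measurable: "oP1 M Z \<Longrightarrow> Z n \<in> borel_measurable M"
  by (simp add: conv_in_prob_def)

lemma oP1D:
  "oP1 M Z \<Longrightarrow> e > 0 \<Longrightarrow> d > 0 \<Longrightarrow> mostly d (\<lambda>n \<omega>. norm (Z n \<omega>) \<le> e)"
  by (simp add: oP1_iff_mostly)

lemma oP1_add:
  fixes Y Z :: "nat \<Rightarrow> 'a \<Rightarrow> 'b :: {real_normed_vector, second_countable_topology}"
  assumes Y: "oP1 M Y" and Z: "oP1 M Z"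
  shows "oP1 M (\<lambda>n \<omega>. Y n \<omega> + Z n \<omega>)"
  unfolding oP1_iff_mostly
proof (intro conjI allI impI)
  note [measurable] = oP1_measurable[OF Y] oP1_measurable[OF Z]
  show "(\<lambda>\<omega>. Y n \<omega> + Z n \<omega>) \<in> borel_measurable M" for n by measurable
  fix e d :: real assume "e > 0" "d > 0"
  then have "mostly d (\<lambda>n \<omega>. norm (Y n \<omega>) \<le> e/2 \<and> norm (Z n \<omega>) \<le> e/2)"
    by (intro mostly_conj_half oP1D Y Z) auto
  then show "mostly d (\<lambda>n \<omega>. norm (Y n \<omega> + Z n \<omega>) \<le> e)"
    by (rule mostly_mono) (auto intro!: always_eventually norm_triangle_le)
qed

lemma oP1_comparison:
  fixes Y :: "nat \<Rightarrow> 'a \<Rightarrow> 'b :: {real_normed_vector, second_countable_topology}"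
    and Z :: "nat \<Rightarrow> 'a \<Rightarrow> 'c :: {real_normed_vector, second_countable_topology}"
  assumes Y: "oP1 M Y" and Z: "\<And>n. Z n \<in> borel_measurable M"
    and le: "\<forall>\<^sub>F n in sequentially. \<forall>\<omega>\<in>space M. norm (Z n \<omega>) \<le> K * norm (Y n \<omega>)"
  shows "oP1 M Z"
  unfolding oP1_iff_mostly
proof (intro conjI allI impI)
  fix e d :: real assume "e > 0" "d > 0"
  \<comment> \<open>\<open>\<bar>K\<bar> + 1\<close> is a positive divisor that dominates
    \<open>K\<close> whatever its sign.\<close>
  have "mostly d (\<lambda>n \<omega>. norm (Y n \<omega>) \<le> e / (\<bar>K\<bar> + 1))"
    using \<open>e > 0\<close> \<open>d > 0\<close> by (intro oP1D Y) (auto intro!: divide_pos_pos add_nonneg_pos)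
  moreover have "norm (Z n \<omega>) \<le> e"
    if "norm (Z n \<omega>) \<le> K * norm (Y n \<omega>)" "norm (Y n \<omega>) \<le> e / (\<bar>K\<bar> + 1)" for n \<omega>
  proof -
    have "K * norm (Y n \<omega>) \<le> (\<bar>K\<bar> + 1) * norm (Y n \<omega>)"
      by (intro mult_right_mono) auto
    also have "\<dots> \<le> (\<bar>K\<bar> + 1) * (e / (\<bar>K\<bar> + 1))"
      using that(2) by (intro mult_left_mono) auto
    also have "\<dots> = e"
      by (simp add: add_nonneg_pos less_imp_neq[symmetric])
    finally show ?thesis using that(1) by simp
  qed
  ultimately show "mostly d (\<lambda>n \<omega>. norm (Z n \<omega>) \<le> e)"
    using le by (elim mostly_mono eventually_mono) blast
qed (rule Z)

lemma oP1_cong_eventually: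
  fixes Y Z :: "nat \<Rightarrow> 'a \<Rightarrow> 'b :: {real_normed_vector, second_countable_topology}"
  assumes "oP1 M Y" "\<And>n. Z n \<in> borel_measurable M"
    and "\<forall>\<^sub>F n in sequentially. \<forall>\<omega>\<in>space M. Z n \<omega> = Y n \<omega>"
  shows "oP1 M Z"
  using assms(3) by (intro oP1_comparison[OF assms(1,2), where K = 1]) (auto elim: eventually_mono)

text \<open>Tightness, with a bound that has to hold only for large \<open>n\<close>, as is built
  into \<open>mostly\<close>.\<close>

definition bounded_in_prob ::
  "(nat \<Rightarrow> 'a \<Rightarrow> 'b :: {real_normed_vector, second_countable_topology}) \<Rightarrow> bool"
  where "bounded_in_prob Z \<longleftrightarrow>
    (\<forall>n. Z n \<in> borel_measurable M) \<and> (\<forall>d>0. \<exists>C. mostly d (\<lambda>n \<omega>. norm (Z n \<omega>) \<le> C))"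

lemma bounded_in_prob_measurable: "bounded_in_prob Z \<Longrightarrow> Z n \<in> borel_measurable M"
  by (simp add: bounded_in_prob_def)

lemma oP1_imp_bounded_in_prob: "oP1 M Z \<Longrightarrow> bounded_in_prob Z"
  by (auto simp: bounded_in_prob_def oP1_iff_mostly intro!: exI[of _ "1 :: real"])

lemma bounded_in_prob_add:
  fixes Y Z :: "nat \<Rightarrow> 'a \<Rightarrow> 'b :: {real_normed_vector, second_countable_topology}"
  assumes Y: "bounded_in_prob Y" and Z: "bounded_in_prob Z"
  shows "bounded_in_prob (\<lambda>n \<omega>. Y n \<omega> + Z n \<omega>)"
  unfolding bounded_in_prob_def
proof (intro conjI allI impI)
  note [measurable] = bounded_in_prob_measurable[OF Y] bounded_in_prob_measurable[OF Z]
  show "(\<lambda>\<omega>. Y n \<omega> + Z n \<omega>) \<in> borel_measurable M" for n by measurable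
  fix d :: real assume "d > 0"
  then obtain C C' where "mostly (d/2) (\<lambda>n \<omega>. norm (Y n \<omega>) \<le> C)" "mostly (d/2) (\<lambda>n \<omega>. norm (Z n \<omega>) \<le> C')"
    using Y Z unfolding bounded_in_prob_def by (meson half_gt_zero)
  then have "mostly d (\<lambda>n \<omega>. norm (Y n \<omega>) \<le> C \<and> norm (Z n \<omega>) \<le> C')"
    by (rule mostly_conj_half)
  then have "mostly d (\<lambda>n \<omega>. norm (Y n \<omega> + Z n \<omega>) \<le> C + C')"
    by (rule mostly_mono) (auto intro!: always_eventually norm_triangle_mono)
  then show "\<exists>C. mostly d (\<lambda>n \<omega>. norm (Y n \<omega> + Z n \<omega>) \<le> C)" by blast
qed

lemma bounded_in_prob_comparison:
  fixes Y :: "nat \<Rightarrow> 'a \<Rightarrow> 'b :: {real_normed_vector, second_countable_topology}"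
    and Z :: "nat \<Rightarrow> 'a \<Rightarrow> 'c :: {real_normed_vector, second_countable_topology}"
  assumes Y: "bounded_in_prob Y" and Z: "\<And>n. Z n \<in> borel_measurable M"
    and le: "\<And>n \<omega>. norm (Z n \<omega>) \<le> norm (Y n \<omega>)"
  shows "bounded_in_prob Z"
  unfolding bounded_in_prob_def
proof (intro conjI allI impI)
  fix d :: real assume "d > 0"
  then obtain C where "mostly d (\<lambda>n \<omega>. norm (Y n \<omega>) \<le> C)"
    using Y unfolding bounded_in_prob_def by meson
  then have "mostly d (\<lambda>n \<omega>. norm (Z n \<omega>) \<le> C)"
    by (rule mostly_mono) (auto intro!: always_eventually order_trans[OF le])
  then show "\<exists>C. mostly d (\<lambda>n \<omega>. norm (Z n \<omega>) \<le> C)" by blast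
qed (rule Z)

lemma bounded_in_prob_Pair:
  fixes Y :: "nat \<Rightarrow> 'a \<Rightarrow> 'b :: {real_normed_vector, second_countable_topology}"
    and Z :: "nat \<Rightarrow> 'a \<Rightarrow> 'c :: {real_normed_vector, second_countable_topology}"
  assumes Y: "bounded_in_prob Y" and Z: "bounded_in_prob Z"
  shows "bounded_in_prob (\<lambda>n \<omega>. (Y n \<omega>, Z n \<omega>))"
proof -
  note [measurable] = bounded_in_prob_measurable[OF Y] bounded_in_prob_measurable[OF Z]
  have "bounded_in_prob (\<lambda>n \<omega>. (Y n \<omega>, 0 :: 'c))" "bounded_in_prob (\<lambda>n \<omega>. (0 :: 'b, Z n \<omega>))"
    by (rule bounded_in_prob_comparison[OF Y] bounded_in_prob_comparison[OF Z];
        simp add: norm_Pair)+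
  from bounded_in_prob_add[OF this] show ?thesis by simp
qed

lemma oP1_Pair:
  fixes Y :: "nat \<Rightarrow> 'a \<Rightarrow> 'b :: {real_normed_vector, second_countable_topology}"
    and Z :: "nat \<Rightarrow> 'a \<Rightarrow> 'c :: {real_normed_vector, second_countable_topology}"
  assumes Y: "oP1 M Y" and Z: "oP1 M Z"
  shows "oP1 M (\<lambda>n \<omega>. (Y n \<omega>, Z n \<omega>))"
proof -
  note [measurable] = oP1_measurable[OF Y] oP1_measurable[OF Z]
  have "oP1 M (\<lambda>n \<omega>. (Y n \<omega>, 0 :: 'c))" "oP1 M (\<lambda>n \<omega>. (0 :: 'b, Z n \<omega>))"
    by (rule oP1_comparison[OF Y, where K = 1] oP1_comparison[OF Z, where K = 1];
        simp add: norm_Pair)+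
  from oP1_add[OF this] show ?thesis by simp
qed

lemma bounded_in_prob_second_moment:
  fixes Z :: "nat \<Rightarrow> 'a \<Rightarrow> real"
  assumes Z[measurable]: "\<And>n. Z n \<in> borel_measurable M"
    and int: "\<And>n. integrable M (\<lambda>\<omega>. (Z n \<omega>)\<^sup>2)" and le: "\<And>n. expectation (\<lambda>\<omega>. (Z n \<omega>)\<^sup>2) \<le> v"
  shows "bounded_in_prob Z"
  unfolding bounded_in_prob_def
proof (intro conjI allI impI Z)
  fix d :: real assume "d > 0"
  have "0 \<le> expectation (\<lambda>\<omega>. (Z 0 \<omega>)\<^sup>2)" by simp
  also note le[of 0]
  finally have "v \<ge> 0" .
  \<comment> \<open>Chebyshev's bound \<open>v / C\<^sup>2\<close> is to be at most
    \<open>d\<close>; \<open>v + 1\<close> instead of \<open>v\<close> keeps \<open>C\<close>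
    positive when all second moments vanish.\<close>
  define C where "C = sqrt ((v + 1) / d)"
  have C: "C > 0" "C\<^sup>2 = (v + 1) / d" using \<open>v \<ge> 0\<close> \<open>d > 0\<close> by (auto simp: C_def)
  have "prob {\<omega> \<in> space M. \<bar>Z n \<omega>\<bar> > C} \<le> d" for n
  proof -
    have "prob {\<omega> \<in> space M. \<bar>Z n \<omega>\<bar> > C} \<le> prob {\<omega> \<in> space M. \<bar>Z n \<omega>\<bar> \<ge> C}"
      by (intro finite_measure_mono) auto
    also have "\<dots> \<le> expectation (\<lambda>\<omega>. (Z n \<omega>)\<^sup>2) / C\<^sup>2"
      by (intro second_moment_method Z int C(1))
    also have "\<dots> \<le> v / C\<^sup>2" using le by (intro divide_right_mono) auto
    also have "\<dots> \<le> d" using \<open>v \<ge> 0\<close> \<open>d > 0\<close> by (simp add: C field_simps)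
    finally show ?thesis .
  qed
  then have "mostly d (\<lambda>n \<omega>. norm (Z n \<omega>) \<le> C)"
    unfolding mostly_def
    by (intro exI[of _ "\<lambda>n. {\<omega> \<in> space M. \<bar>Z n \<omega>\<bar> > C}"] always_eventually) auto
  then show "\<exists>C. mostly d (\<lambda>n \<omega>. norm (Z n \<omega>) \<le> C)" by blast
qed

lemma oP1_second_moment:
  fixes Z :: "nat \<Rightarrow> 'a \<Rightarrow> real"
  assumes Z[measurable]: "\<And>n. Z n \<in> borel_measurable M"
    and int: "\<And>n. integrable M (\<lambda>\<omega>. (Z n \<omega>)\<^sup>2)"
    and lim: "(\<lambda>n. expectation (\<lambda>\<omega>. (Z n \<omega>)\<^sup>2)) \<longlonglongrightarrow> 0"
  shows "oP1 M Z"
  unfolding conv_in_prob_def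
proof (intro conjI allI impI Z)
  fix e :: real assume "e > 0"
  have "prob {\<omega> \<in> space M. dist (Z n \<omega>) 0 > e} \<le> expectation (\<lambda>\<omega>. (Z n \<omega>)\<^sup>2) / e\<^sup>2" for n
  proof -
    have "prob {\<omega> \<in> space M. dist (Z n \<omega>) 0 > e} \<le> prob {\<omega> \<in> space M. \<bar>Z n \<omega>\<bar> \<ge> e}"
      by (intro finite_measure_mono) auto
    also have "\<dots> \<le> expectation (\<lambda>\<omega>. (Z n \<omega>)\<^sup>2) / e\<^sup>2"
      by (intro second_moment_method Z int \<open>e > 0\<close>)
    finally show ?thesis .
  qed
  moreover have "(\<lambda>n. expectation (\<lambda>\<omega>. (Z n \<omega>)\<^sup>2) / e\<^sup>2) \<longlonglongrightarrow> 0"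
    using tendsto_divide[OF lim tendsto_const[of "e\<^sup>2"]] \<open>e > 0\<close> by simp
  ultimately show "(\<lambda>n. prob {\<omega> \<in> space M. dist (Z n \<omega>) 0 > e}) \<longlonglongrightarrow> 0"
    by (intro real_tendsto_sandwich[OF _ _ tendsto_const
          \<open>(\<lambda>n. expectation (\<lambda>\<omega>. (Z n \<omega>)\<^sup>2) / e\<^sup>2) \<longlonglongrightarrow> 0\<close>]) auto
qed

text \<open>Differentiability at the single point \<open>w\<close> suffices because
  \<open>W n\<close> is within \<open>C / sqrt n\<close> of \<open>w\<close> up to small
  probability. It does not make \<open>f\<close> a Borel function, so measurability of the
  composition is assumed separately.\<close>

lemma delta_method:
  fixes W :: "nat \<Rightarrow> 'a \<Rightarrow> 'b :: euclidean_space" and f :: "'b \<Rightarrow> real"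
  assumes expansion: "oP1 M (\<lambda>n \<omega>. sqrt (real n) *\<^sub>R (W n \<omega> - w) - S n \<omega>)"
    and S: "bounded_in_prob S"
    and deriv: "(f has_derivative f') (at w)"
    and fW[measurable]: "\<And>n. (\<lambda>\<omega>. f (W n \<omega>)) \<in> borel_measurable M"
  shows "oP1 M (\<lambda>n \<omega>. sqrt (real n) * (f (W n \<omega>) - f w) - f' (S n \<omega>))"
  unfolding oP1_iff_mostly
proof (intro conjI allI impI)
  interpret f': bounded_linear f' using deriv by (rule has_derivative_bounded_linear)
  note [measurable] = bounded_in_prob_measurable[OF S]
  have [measurable]: "f' \<in> borel_measurable borel"
    by (intro borel_measurable_continuous_onI linear_continuous_on f'.bounded_linear_axioms)
  show "(\<lambda>\<omega>. sqrt (real n) * (f (W n \<omega>) - f w) - f' (S n \<omega>)) \<in> borel_measurable M" for n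
    by measurable
  fix e d :: real assume "e > 0" "d > 0"
  define V where "V n \<omega> = sqrt (real n) *\<^sub>R (W n \<omega> - w)" for n \<omega>
  have "bounded_in_prob V"
    using bounded_in_prob_add[OF oP1_imp_bounded_in_prob[OF expansion] S] by (simp add: V_def[abs_def])
  then obtain C' where C': "mostly (d/2) (\<lambda>n \<omega>. norm (V n \<omega>) \<le> C')"
    using \<open>d > 0\<close> unfolding bounded_in_prob_def by (meson half_gt_zero)
  define C where "C = \<bar>C'\<bar> + 1"
  have "C > 0" "C' \<le> C" by (auto simp: C_def)
  obtain K where K: "K > 0" "\<And>x. norm (f' x) \<le> norm x * K"
    using f'.pos_bounded by blast
  \<comment> \<open>On the good event the scaled remainder is at most \<open>r * C\<close>, half of
    \<open>e\<close>; the other half pays for replacing \<open>V\<close> by \<open>S\<close> inside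
    the linear map, whose norm is at most \<open>K\<close>.\<close>
  define r where "r = e / (2 * C)"
  have "r > 0" using \<open>e > 0\<close> \<open>C > 0\<close> by (simp add: r_def)
  then obtain \<delta> where \<delta>: "\<delta> > 0"
    "\<And>y. norm (y - w) < \<delta> \<Longrightarrow> norm (f y - f w - f' (y - w)) \<le> r * norm (y - w)"
    using deriv unfolding has_derivative_at_alt by blast
  have "mostly d (\<lambda>n \<omega>. norm (V n \<omega>) \<le> C' \<and> norm (V n \<omega> - S n \<omega>) \<le> e / (2 * K))"
    using mostly_conj_half[OF C' oP1D[OF expansion, of "e / (2 * K)"]] \<open>e > 0\<close> \<open>d > 0\<close> K(1)
    by (simp add: V_def)
  moreover have "\<forall>\<^sub>F n in sequentially. C / sqrt (real n) < \<delta>"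
    using \<open>\<delta> > 0\<close> by (intro order_tendstoD(2)[of _ 0])
      (auto intro!: tendsto_divide_0 filterlim_at_top_imp_at_infinity filterlim_compose[OF sqrt_at_top]
        filterlim_real_sequentially)
  with eventually_gt_at_top[of 0] have "\<forall>\<^sub>F n in sequentially. \<forall>\<omega>\<in>space M.
     norm (V n \<omega>) \<le> C' \<and> norm (V n \<omega> - S n \<omega>) \<le> e / (2 * K) \<longrightarrow>
     norm (sqrt (real n) * (f (W n \<omega>) - f w) - f' (S n \<omega>)) \<le> e"
  proof (eventually_elim, intro ballI impI, elim conjE)
    fix n \<omega> assume n: "n > 0" "C / sqrt (real n) < \<delta>"
      and V: "norm (V n \<omega>) \<le> C'" and VS: "norm (V n \<omega> - S n \<omega>) \<le> e / (2 * K)"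
    have VC: "sqrt (real n) * norm (W n \<omega> - w) \<le> C"
      using V \<open>C' \<le> C\<close> by (simp add: V_def)
    then have "norm (W n \<omega> - w) \<le> C / sqrt (real n)"
      using n by (simp add: field_simps)
    then have "norm (f (W n \<omega>) - f w - f' (W n \<omega> - w)) \<le> r * norm (W n \<omega> - w)"
      using n by (intro \<delta>(2)) simp
    then have "sqrt (real n) * norm (f (W n \<omega>) - f w - f' (W n \<omega> - w)) \<le> r * (sqrt (real n) * norm (W n \<omega> - w))"
      using n by (simp add: field_simps)
    also have "\<dots> \<le> r * C" using VC \<open>r > 0\<close> by (intro mult_left_mono) auto
    also have "\<dots> = e / 2" using \<open>C > 0\<close> by (simp add: r_def)
    finally have 1: "norm (sqrt (real n) * (f (W n \<omega>) - f w) - f' (V n \<omega>)) \<le> e / 2"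
      using n by (simp add: V_def f'.scaleR abs_mult right_diff_distrib[symmetric])
    have "norm (f' (V n \<omega>) - f' (S n \<omega>)) \<le> norm (V n \<omega> - S n \<omega>) * K"
      using K(2) by (simp add: f'.diff[symmetric])
    also have "\<dots> \<le> e / (2 * K) * K"
      using VS K(1) by (intro mult_right_mono) auto
    finally have 2: "norm (f' (V n \<omega>) - f' (S n \<omega>)) \<le> e / 2" using K(1) by simp
    show "norm (sqrt (real n) * (f (W n \<omega>) - f w) - f' (S n \<omega>)) \<le> e"
      using norm_triangle_mono[OF 1 2] by simp
  qed
  ultimately show "mostly d (\<lambda>n \<omega>. norm (sqrt (real n) * (f (W n \<omega>) - f w) - f' (S n \<omega>)) \<le> e)"
    by (rule mostly_mono)
qed

end

subsection \<open>Normalized sums of i.i.d. random variables\<close>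

text \<open>A new summand is independent of the preceding partial sum and centred, so the cross term
  has mean zero and the second moment grows by exactly \<open>v\<close>.\<close>

lemma (in prob_space) square_expectation_sum_indep:
  fixes Y :: "nat \<Rightarrow> 'a \<Rightarrow> real"
  assumes indep: "indep_vars (\<lambda>_. borel) Y UNIV"
    and sq: "\<And>i. integrable M (\<lambda>\<omega>. (Y i \<omega>)\<^sup>2)"
    and mean: "\<And>i. expectation (Y i) = 0"
    and var: "\<And>i. expectation (\<lambda>\<omega>. (Y i \<omega>)\<^sup>2) = v"
  shows "integrable M (\<lambda>\<omega>. (\<Sum>i<n. Y i \<omega>)\<^sup>2) \<and> expectation (\<lambda>\<omega>. (\<Sum>i<n. Y i \<omega>)\<^sup>2) = real n * v"
proof (induction n)
  case 0
  show ?case by simp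
next
  case (Suc n)
  let ?S = "\<lambda>\<omega>. \<Sum>i<n. Y i \<omega>"
  have [measurable]: "Y i \<in> borel_measurable M" for i
    using indep by (simp add: indep_vars_def)
  have int: "integrable M (Y i)" for i
    by (rule square_integrable_imp_integrable[OF _ sq]) simp
  then have intS: "integrable M ?S" by simp
  have ind: "indep_var borel (Y n) borel ?S"
    using indep_vars_subset[OF indep, of "insert n {..<n}"] by (intro indep_vars_sum) auto
  have 0: "expectation (\<lambda>\<omega>. Y n \<omega> * ?S \<omega>) = 0"
    using indep_var_lebesgue_integral[OF ind int intS] by (simp add: mean)
  have eq: "(\<lambda>\<omega>. (\<Sum>i<Suc n. Y i \<omega>)\<^sup>2) = (\<lambda>\<omega>. (?S \<omega>)\<^sup>2 + 2 * (Y n \<omega> * ?S \<omega>) + (Y n \<omega>)\<^sup>2)"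
    by (simp add: power2_sum algebra_simps)
  show ?case
    unfolding eq using Suc sq[of n] indep_var_integrable[OF ind int intS] 0 var[of n]
    by (simp add: algebra_simps)
qed

section \<open>The normal limit law and Slutsky's lemma through characteristic functions\<close>

lemma real_distribution_normal_law:
  assumes "v \<ge> 0"
  shows "real_distribution (normal_law a v)"
proof (cases "v = 0")
  case True
  interpret prob_space "return borel a" by (rule prob_space_return) simp
  show ?thesis
    using True by (simp add: normal_law_def) (unfold_locales; simp)
next
  case False
  then interpret prob_space "density lborel (\<lambda>x. ennreal (normal_density a (sqrt v) x))"
    using assms by (intro prob_space_normal_density) simp
  show ?thesis
    using False by (simp add: normal_law_def) (unfold_locales; simp)
qed

text \<open>One formula serves the point mass and the proper normal laws; the latter are images of
  the standard normal law under multiplication by \<open>sqrt v\<close>.\<close>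

lemma char_normal_law_0:
  assumes "v \<ge> 0"
  shows "char (normal_law 0 v) t = complex_of_real (exp (- (v * t\<^sup>2) / 2))"
proof (cases "v = 0")
  case True
  then show ?thesis by (simp add: normal_law_def char_def integral_return)
next
  case False
  then have "v > 0" using assms by simp
  interpret N: real_distribution std_normal_distribution by (rule real_dist_normal_dist)
  have "distributed std_normal_distribution lborel (\<lambda>x. x) std_normal_density"
    by (simp add: distributed_def distr_id2)
  from N.normal_density_affine[OF this, of "sqrt v" 0] \<open>v > 0\<close>
  have "distributed std_normal_distribution lborel (\<lambda>x. sqrt v * x) (normal_density 0 (sqrt v))"
    by simp
  then have law: "normal_law 0 v = distr std_normal_distribution lborel (\<lambda>x. sqrt v * x)"
    using \<open>v > 0\<close> by (simp add: normal_law_def distributed_def)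
  have "char (normal_law 0 v) t = (CLINT x|std_normal_distribution. iexp (t * (sqrt v * x)))"
    unfolding char_def law by (simp add: integral_distr)
  also have "\<dots> = char std_normal_distribution (t * sqrt v)"
    by (simp add: char_def mult.assoc)
  also have "\<dots> = complex_of_real (exp (- (v * t\<^sup>2) / 2))"
    using assms by (simp add: char_std_normal_distribution power_mult_distrib mult.commute)
  finally show ?thesis .
qed

lemma cmod_iexp_diff_le: "cmod (iexp x - iexp y) \<le> \<bar>x - y\<bar>" for x y :: real
proof -
  have "iexp x - iexp y = iexp y * (iexp (x - y) - 1)"
    by (simp add: algebra_simps exp_add[symmetric])
  then have "cmod (iexp x - iexp y) = cmod (iexp (x - y) - 1)"
    by (simp add: norm_mult)
  also have "\<dots> \<le> \<bar>x - y\<bar>" using iexp_approx1[of "x - y" 0] by simp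
  finally show ?thesis .
qed

text \<open>The integrand \<open>iexp (t * x)\<close> is Lipschitz in \<open>x\<close> with constant
  \<open>\<bar>t\<bar>\<close> and has modulus 1. Hence the difference costs
  \<open>\<bar>t\<bar> * e\<close> where \<open>Y n\<close> and \<open>Z n\<close> are
  \<open>e\<close>-close, and at most 2 on the small exceptional event.\<close>

lemma (in prob_space) oP1_imp_char_diff_tendsto_0:
  fixes Y Z :: "nat \<Rightarrow> 'a \<Rightarrow> real"
  assumes Y[measurable]: "\<And>n. Y n \<in> borel_measurable M"
    and Z[measurable]: "\<And>n. Z n \<in> borel_measurable M"
    and diff: "oP1 M (\<lambda>n \<omega>. Z n \<omega> - Y n \<omega>)"
  shows "(\<lambda>n. char (distr M borel (Z n)) t - char (distr M borel (Y n)) t) \<longlonglongrightarrow> 0"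
proof (rule LIMSEQ_I)
  fix r :: real assume "r > 0"
  \<comment> \<open>This leaves less than \<open>r / 2\<close> for the Lipschitz part, also for
    \<open>t = 0\<close>; probability \<open>r / 4\<close> of the exceptional event, counted twice,
    gives the other half.\<close>
  define e where "e = r / (2 * (\<bar>t\<bar> + 1))"
  have "e > 0" using \<open>r > 0\<close> by (simp add: e_def add_nonneg_pos)
  have te: "\<bar>t\<bar> * e < r / 2"
    using \<open>r > 0\<close> by (simp add: e_def field_simps add_nonneg_pos)
  obtain A where A: "\<forall>\<^sub>F n in sequentially. A n \<in> events \<and> prob (A n) \<le> r / 4 \<and>
      (\<forall>\<omega>\<in>space M - A n. norm (Z n \<omega> - Y n \<omega>) \<le> e)"
    using oP1D[OF diff \<open>e > 0\<close>, of "r / 4"] \<open>r > 0\<close> by (auto simp: mostly_def)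
  have "\<forall>\<^sub>F n in sequentially.
      norm (char (distr M borel (Z n)) t - char (distr M borel (Y n)) t - 0) < r"
    using A
  proof eventually_elim
    case (elim n)
    then have [measurable]: "A n \<in> events" by simp
    have int_A: "integrable M (indicator (A n) :: 'a \<Rightarrow> real)"
      using elim by (intro integrable_real_indicator) (simp_all add: emeasure_eq_measure)
    have i: "integrable M (\<lambda>\<omega>. iexp (t * Z n \<omega>))" "integrable M (\<lambda>\<omega>. iexp (t * Y n \<omega>))"
      by (rule integrable_iexp; simp)+
    have "char (distr M borel (Z n)) t - char (distr M borel (Y n)) t
        = (CLINT \<omega>|M. iexp (t * Z n \<omega>) - iexp (t * Y n \<omega>))"
      using i by (simp add: char_def integral_distr)
    also have "norm \<dots> \<le> (\<integral>\<omega>. cmod (iexp (t * Z n \<omega>) - iexp (t * Y n \<omega>)) \<partial>M)"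
      by (rule integral_norm_bound)
    also have "\<dots> \<le> (\<integral>\<omega>. \<bar>t\<bar> * e + 2 * indicator (A n) \<omega> \<partial>M)"
    proof (rule integral_mono)
      show "integrable M (\<lambda>\<omega>. cmod (iexp (t * Z n \<omega>) - iexp (t * Y n \<omega>)))"
        using i by (intro integrable_norm Bochner_Integration.integrable_diff)
      show "integrable M (\<lambda>\<omega>. \<bar>t\<bar> * e + 2 * indicator (A n) \<omega>)"
        by (intro Bochner_Integration.integrable_add integrable_mult_right integrable_const int_A)
      fix \<omega> assume "\<omega> \<in> space M"
      show "cmod (iexp (t * Z n \<omega>) - iexp (t * Y n \<omega>)) \<le> \<bar>t\<bar> * e + 2 * indicator (A n) \<omega>"
      proof (cases "\<omega> \<in> A n")
        case True
        have "cmod (iexp (t * Z n \<omega>) - iexp (t * Y n \<omega>)) \<le> 2"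
          using norm_triangle_ineq4[of "iexp (t * Z n \<omega>)" "iexp (t * Y n \<omega>)"] by simp
        then show ?thesis using True \<open>e > 0\<close> by (simp add: add_increasing)
      next
        case False
        have "cmod (iexp (t * Z n \<omega>) - iexp (t * Y n \<omega>)) \<le> \<bar>t * Z n \<omega> - t * Y n \<omega>\<bar>"
          by (rule cmod_iexp_diff_le)
        also have "\<dots> = \<bar>t\<bar> * \<bar>Z n \<omega> - Y n \<omega>\<bar>"
          by (simp add: abs_mult right_diff_distrib[symmetric])
        also have "\<dots> \<le> \<bar>t\<bar> * e"
          using elim False \<open>\<omega> \<in> space M\<close> by (intro mult_left_mono) auto
        finally show ?thesis using False by simp
      qed
    qed
    also have "\<dots> = \<bar>t\<bar> * e + 2 * prob (A n)"
      by (subst Bochner_Integration.integral_add) (simp_all add: int_A prob_space)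
    also have "\<dots> < r" using te elim by simp
    finally show ?case by simp
  qed
  then show "\<exists>no. \<forall>n\<ge>no. norm (char (distr M borel (Z n)) t - char (distr M borel (Y n)) t - 0) < r"
    by (simp add: eventually_sequentially)
qed

section \<open>Moments, central limit theorem and empirical process of an i.i.d. sample\<close>

locale iid_sample = prob_space M for M :: "'w measure" +
  fixes X :: "nat \<Rightarrow> 'w \<Rightarrow> real" and P :: "real measure"
  assumes X_rv[measurable]: "\<And>i. X i \<in> borel_measurable M"
    and X_indep: "indep_vars (\<lambda>_. borel) X UNIV"
    and X_law: "\<And>i. distr M borel (X i) = P"
begin

lemma sets_P[measurable_cong]: "sets P = sets borel" and space_P[simp]: "space P = UNIV"
  by (auto simp: X_law[of 0, symmetric])

lemma prob_space_P: "prob_space P"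
  using X_law[of 0] by (metis prob_space_distr X_rv)

sublocale P: prob_space P by (rule prob_space_P)

lemma
  fixes h :: "real \<Rightarrow> real"
  assumes [measurable]: "h \<in> borel_measurable borel"
  shows integrable_X_iff: "integrable M (\<lambda>\<omega>. h (X i \<omega>)) \<longleftrightarrow> integrable P h"
    and expectation_X: "expectation (\<lambda>\<omega>. h (X i \<omega>)) = (\<integral>x. h x \<partial>P)"
  unfolding X_law[of i, symmetric] by (simp_all add: integrable_distr_eq integral_distr)

definition normed_sum :: "(real \<Rightarrow> real) \<Rightarrow> nat \<Rightarrow> 'w \<Rightarrow> real"
  where "normed_sum h n \<omega> = 1 / sqrt (real n) * (\<Sum>i<n. h (X i \<omega>))"

lemma normed_sum_measurable[measurable]:
  assumes [measurable]: "h \<in> borel_measurable borel"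
  shows "normed_sum h n \<in> borel_measurable M"
  unfolding normed_sum_def[abs_def] by measurable

context
  fixes h :: "real \<Rightarrow> real"
  assumes h[measurable]: "h \<in> borel_measurable borel"
    and h_sq: "integrable P (\<lambda>x. (h x)\<^sup>2)" and h_mean: "(\<integral>x. h x \<partial>P) = 0"
begin

lemma
  shows indep_vars_h: "indep_vars (\<lambda>_. borel) (\<lambda>i \<omega>. h (X i \<omega>)) UNIV"
    and integrable_h_sq: "integrable M (\<lambda>\<omega>. (h (X i \<omega>))\<^sup>2)"
    and expectation_h: "expectation (\<lambda>\<omega>. h (X i \<omega>)) = 0"
    and expectation_h_sq: "expectation (\<lambda>\<omega>. (h (X i \<omega>))\<^sup>2) = (\<integral>x. (h x)\<^sup>2 \<partial>P)"
  using h_sq h_mean integrable_X_iff[of "\<lambda>x. (h x)\<^sup>2" i] expectation_X[of h i]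
    expectation_X[of "\<lambda>x. (h x)\<^sup>2" i] indep_vars_compose2[OF X_indep, of "\<lambda>_. h"]
  by auto

text \<open>The second moment equals the bound for \<open>n > 0\<close>; at \<open>n = 0\<close> the
  convention \<open>1 / 0 = 0\<close> makes the normalized sum vanish, so the uniform statement is
  an inequality.\<close>

lemma
  shows integrable_normed_sum_sq: "integrable M (\<lambda>\<omega>. (normed_sum h n \<omega>)\<^sup>2)"
    and expectation_normed_sum_sq_le: "expectation (\<lambda>\<omega>. (normed_sum h n \<omega>)\<^sup>2) \<le> (\<integral>x. (h x)\<^sup>2 \<partial>P)"
proof -
  let ?v = "\<integral>x. (h x)\<^sup>2 \<partial>P"
  from square_expectation_sum_indep[OF indep_vars_h integrable_h_sq expectation_h expectation_h_sq]
  have S: "integrable M (\<lambda>\<omega>. (\<Sum>i<n. h (X i \<omega>))\<^sup>2)" "expectation (\<lambda>\<omega>. (\<Sum>i<n. h (X i \<omega>))\<^sup>2) = real n * ?v"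
    by auto
  have eq: "(\<lambda>\<omega>. (normed_sum h n \<omega>)\<^sup>2) = (\<lambda>\<omega>. (1 / real n) * (\<Sum>i<n. h (X i \<omega>))\<^sup>2)"
    by (simp add: normed_sum_def power_mult_distrib power_divide)
  show "integrable M (\<lambda>\<omega>. (normed_sum h n \<omega>)\<^sup>2)"
    unfolding eq by (intro integrable_mult_right S)
  show "expectation (\<lambda>\<omega>. (normed_sum h n \<omega>)\<^sup>2) \<le> ?v"
    unfolding eq using S(2) by (cases "n = 0") auto
qed

lemma bounded_in_prob_normed_sum: "bounded_in_prob (normed_sum h)"
  by (rule bounded_in_prob_second_moment[OF _ integrable_normed_sum_sq expectation_normed_sum_sq_le]) simp

text \<open>The central limit theorem applies only to positive variance. If the variance is zero,
  \<open>h\<close> vanishes almost everywhere, so do all normalized sums, and the limit is the point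
  mass.\<close>

lemma char_normed_sum_tendsto:
  "(\<lambda>n. char (distr M borel (normed_sum h n)) t) \<longlonglongrightarrow> char (normal_law 0 (\<integral>x. (h x)\<^sup>2 \<partial>P)) t"
proof -
  let ?v = "\<integral>x. (h x)\<^sup>2 \<partial>P"
  have "?v \<ge> 0" by simp
  show ?thesis
  proof (cases "?v = 0")
    case True
    have "AE x in P. h x = 0"
      using True h_sq by (simp add: integral_nonneg_eq_0_iff_AE)
    then have "AE \<omega> in M. h (X i \<omega>) = 0" for i
      unfolding X_law[of i, symmetric] by (simp add: AE_distr_iff)
    then have "AE \<omega> in M. \<forall>i. h (X i \<omega>) = 0" by (simp add: AE_all_countable)
    then have "AE \<omega> in M. iexp (t * normed_sum h n \<omega>) = 1" for n
      by eventually_elim (simp add: normed_sum_def)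
    then have "(CLINT \<omega>|M. iexp (t * normed_sum h n \<omega>)) = (CLINT \<omega>|M. 1)" for n
      by (intro integral_cong_AE) auto
    then have "char (distr M borel (normed_sum h n)) t = 1" for n
      by (simp add: char_def integral_distr prob_space)
    moreover have "char (normal_law 0 ?v) t = 1"
      using True by (simp add: char_normal_law_0)
    ultimately show ?thesis by simp
  next
    case False
    with \<open>?v \<ge> 0\<close> have v: "?v > 0" by (metis order_less_le)
    have "distr M borel (\<lambda>\<omega>. h (X i \<omega>)) = distr P borel h" for i
      by (subst X_law[of i, symmetric], subst distr_distr) (auto simp: comp_def)
    from central_limit_theorem_zero_mean[OF indep_vars_h expectation_h _ integrable_h_sq _ this, of "sqrt ?v"]
    have "weak_conv_m (\<lambda>n. distr M borel (\<lambda>\<omega>. (\<Sum>i<n. h (X i \<omega>)) / sqrt (real n * ?v)))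
      std_normal_distribution"
      using v by (simp add: expectation_h expectation_h_sq)
    \<comment> \<open>The theorem standardizes by \<open>sqrt (n * v)\<close>; evaluating its
      characteristic functions at \<open>t * sqrt v\<close> undoes the extra factor.\<close>
    then have "(\<lambda>n. char (distr M borel (\<lambda>\<omega>. (\<Sum>i<n. h (X i \<omega>)) / sqrt (real n * ?v))) (t * sqrt ?v))
      \<longlonglongrightarrow> char std_normal_distribution (t * sqrt ?v)"
      by (intro levy_continuity1) (auto intro: real_dist_normal_dist)
    moreover have "char (distr M borel (\<lambda>\<omega>. (\<Sum>i<n. h (X i \<omega>)) / sqrt (real n * ?v))) (t * sqrt ?v)
      = char (distr M borel (normed_sum h n)) t" for n
      using v by (simp add: char_def integral_distr normed_sum_def real_sqrt_mult mult.assoc)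
    moreover have "char std_normal_distribution (t * sqrt ?v) = char (normal_law 0 ?v) t"
      using v by (simp add: char_normal_law_0 char_std_normal_distribution power_mult_distrib mult.commute)
    ultimately show ?thesis by simp
  qed
qed

text \<open>The negligible difference and the central limit theorem are added at the level of
  characteristic functions, and Levy's continuity theorem returns to weak convergence.\<close>

lemma asymptotically_linear_imp_normal:
  fixes Z :: "nat \<Rightarrow> 'w \<Rightarrow> real"
  assumes Z[measurable]: "\<And>n. Z n \<in> borel_measurable M"
    and lin: "oP1 M (\<lambda>n \<omega>. Z n \<omega> - normed_sum h n \<omega>)"
  shows "weak_conv_m (\<lambda>n. distr M borel (Z n)) (normal_law 0 (\<integral>x. (h x)\<^sup>2 \<partial>P))"
proof (rule levy_continuity)
  show "real_distribution (normal_law 0 (\<integral>x. (h x)\<^sup>2 \<partial>P))"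
    by (rule real_distribution_normal_law) simp
  show "(\<lambda>n. char (distr M borel (Z n)) t) \<longlonglongrightarrow> char (normal_law 0 (\<integral>x. (h x)\<^sup>2 \<partial>P)) t" for t
    using tendsto_add[OF oP1_imp_char_diff_tendsto_0[OF _ Z lin, of t] char_normed_sum_tendsto[of t]]
    by simp
qed simp

end

lemma
  fixes f :: "real \<Rightarrow> real"
  assumes [measurable]: "f \<in> borel_measurable borel" and f_sq: "integrable P (\<lambda>x. (f x)\<^sup>2)"
  shows square_integrable_centered: "integrable P (\<lambda>x. (f x - (\<integral>y. f y \<partial>P))\<^sup>2)"
    and mean_centered: "(\<integral>x. f x - (\<integral>y. f y \<partial>P) \<partial>P) = 0"
    and integral_square_centered_le: "(\<integral>x. (f x - (\<integral>y. f y \<partial>P))\<^sup>2 \<partial>P) \<le> (\<integral>x. (f x)\<^sup>2 \<partial>P)"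
proof -
  have f: "integrable P f"
    by (rule P.square_integrable_imp_integrable[OF _ f_sq]) simp
  show "integrable P (\<lambda>x. (f x - (\<integral>y. f y \<partial>P))\<^sup>2)"
    using f f_sq by (simp add: power2_diff)
  show "(\<integral>x. f x - (\<integral>y. f y \<partial>P) \<partial>P) = 0"
    using f by (simp add: P.prob_space[simplified])
  show "(\<integral>x. (f x - (\<integral>y. f y \<partial>P))\<^sup>2 \<partial>P) \<le> (\<integral>x. (f x)\<^sup>2 \<partial>P)"
    using P.variance_eq[OF f f_sq] by simp
qed

text \<open>Distributing the mean over the summands exhibits the process as a normalized sum of
  centred terms, which opens it to the moment bounds above. Both sides are 0 at
  \<open>n = 0\<close>.\<close>

lemma empirical_process_eq_normed_sum:
  "empirical_process P n (\<lambda>i. X i \<omega>) f = normed_sum (\<lambda>x. f x - (\<integral>y. f y \<partial>P)) n \<omega>"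
proof (cases "n = 0")
  case False
  then have "sqrt (real n) * sqrt (real n) = real n" "sqrt (real n) > 0" by simp_all
  then show ?thesis
    by (simp add: empirical_process_def normed_sum_def sum_subtractf field_simps)
qed (simp add: empirical_process_def normed_sum_def)

text \<open>The functions may change with \<open>n\<close> but are nonrandom, so Chebyshev suffices:
  the variance is at most the second moment under \<open>P\<close>.\<close>

lemma oP1_empirical_process:
  assumes f[measurable]: "\<And>n. f n \<in> borel_measurable borel"
    and f_sq: "\<And>n. integrable P (\<lambda>x. (f n x)\<^sup>2)" and lim: "(\<lambda>n. \<integral>x. (f n x)\<^sup>2 \<partial>P) \<longlonglongrightarrow> 0"
  shows "oP1 M (\<lambda>n \<omega>. empirical_process P n (\<lambda>i. X i \<omega>) (f n))"
  unfolding empirical_process_eq_normed_sum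
proof (rule oP1_second_moment)
  note centered = square_integrable_centered[OF f f_sq] mean_centered[OF f f_sq]
  show "integrable M (\<lambda>\<omega>. (normed_sum (\<lambda>x. f n x - (\<integral>y. f n y \<partial>P)) n \<omega>)\<^sup>2)" for n
    by (intro integrable_normed_sum_sq centered) simp
  have "expectation (\<lambda>\<omega>. (normed_sum (\<lambda>x. f n x - (\<integral>y. f n y \<partial>P)) n \<omega>)\<^sup>2) \<le> (\<integral>x. (f n x)\<^sup>2 \<partial>P)" for n
    by (rule order_trans[OF expectation_normed_sum_sq_le integral_square_centered_le[OF f f_sq]])
      (simp, rule centered, rule centered)
  then show "(\<lambda>n. expectation (\<lambda>\<omega>. (normed_sum (\<lambda>x. f n x - (\<integral>y. f n y \<partial>P)) n \<omega>)\<^sup>2)) \<longlonglongrightarrow> 0"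
    by (intro real_tendsto_sandwich[OF _ _ tendsto_const lim]) auto
qed simp

end

subsection \<open>Local behaviour of the location-scale empirical process\<close>

lemma gradient_eqI:
  assumes "GDERIV f \<theta> :> D"
  shows "gradient f \<theta> = D"
  unfolding gradient_def
proof (rule the_equality)
  fix E assume "GDERIV f \<theta> :> E"
  then have "(\<lambda>h. h \<bullet> E) = (\<lambda>h. h \<bullet> D)"
    using assms unfolding gderiv_def by (rule has_derivative_unique)
  then have "(E - D) \<bullet> (E - D) = 0"
    by (simp add: inner_diff_right fun_eq_iff)
  then show "E = D" by simp
qed (rule assms)

text \<open>The vector representing the derivative is assembled from its values on the basis; its
  uniqueness then resolves the definite description in \<open>gradient\<close>.\<close>

lemma has_derivative_gradient:
  fixes f :: "'t :: euclidean_space \<Rightarrow> real"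
  assumes "f differentiable at \<theta>"
  shows "(f has_derivative (\<lambda>h. h \<bullet> gradient f \<theta>)) (at \<theta>)"
proof -
  obtain f' where f': "(f has_derivative f') (at \<theta>)"
    using assms by (auto simp: differentiable_def)
  then interpret bounded_linear f' by (rule has_derivative_bounded_linear)
  have "f' h = h \<bullet> (\<Sum>b\<in>Basis. f' b *\<^sub>R b)" for h
  proof -
    have "f' h = f' (\<Sum>b\<in>Basis. (h \<bullet> b) *\<^sub>R b)" by (simp only: euclidean_representation)
    also have "\<dots> = h \<bullet> (\<Sum>b\<in>Basis. f' b *\<^sub>R b)"
      by (simp add: sum scaleR inner_sum_right mult.commute)
    finally show ?thesis .
  qed
  then have "f' = (\<lambda>h. h \<bullet> (\<Sum>b\<in>Basis. f' b *\<^sub>R b))" by blast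
  with f' have "GDERIV f \<theta> :> (\<Sum>b\<in>Basis. f' b *\<^sub>R b)"
    unfolding gderiv_def by metis
  then show ?thesis by (simp add: gradient_eqI gderiv_def)
qed

text \<open>This is nonnegativity of the variance of \<open>\<bar>f\<bar>\<close>.\<close>

lemma (in prob_space) expectation_abs_le_L2_norm:
  fixes f :: "'a \<Rightarrow> real"
  assumes [measurable]: "f \<in> borel_measurable M" and sq: "integrable M (\<lambda>x. (f x)\<^sup>2)"
  shows "expectation (\<lambda>x. \<bar>f x\<bar>) \<le> L2_norm M f"
proof -
  have "integrable M f" by (rule square_integrable_imp_integrable[OF _ sq]) simp
  then have "0 \<le> expectation (\<lambda>x. \<bar>f x\<bar>\<^sup>2) - (expectation (\<lambda>x. \<bar>f x\<bar>))\<^sup>2"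
    using variance_positive[of "\<lambda>x. \<bar>f x\<bar>"] sq by (subst variance_eq[symmetric]) auto
  then show ?thesis
    unfolding L2_norm_def by (intro real_le_rsqrt) simp
qed

lemma empirical_process_diff:
  assumes "integrable P f" "integrable P g"
  shows "empirical_process P n x (\<lambda>y. f y - g y) = empirical_process P n x f - empirical_process P n x g"
  using assms by (simp add: empirical_process_def sum_subtractf diff_divide_distrib algebra_simps)

text \<open>Replacing the signed measure \<open>P\<^sub>n - P\<close> by \<open>P\<^sub>n + P = (P\<^sub>n - P) + 2 P\<close> keeps the envelope
  \<open>B\<close> inside a single empirical process.\<close>

lemma empirical_process_diff_le:
  assumes f: "integrable P f" and g: "integrable P g" and B: "integrable P B"
    and le: "\<And>y. \<bar>f y - g y\<bar> \<le> B y"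
  shows "\<bar>empirical_process P n x f - empirical_process P n x g\<bar>
    \<le> empirical_process P n x B + 2 * (sqrt (real n) * (\<integral>y. B y \<partial>P))"
proof -
  have "\<bar>(\<Sum>i<n. f (x i) - g (x i))\<bar> \<le> (\<Sum>i<n. B (x i))"
    by (rule order_trans[OF sum_abs sum_mono]) (rule le)
  then have 1: "\<bar>(\<Sum>i<n. f (x i) - g (x i)) / real n\<bar> \<le> (\<Sum>i<n. B (x i)) / real n"
    by (simp add: divide_right_mono)
  have "\<bar>\<integral>y. f y - g y \<partial>P\<bar> \<le> (\<integral>y. \<bar>f y - g y\<bar> \<partial>P)"
    by (rule integral_abs_bound)
  also have "\<dots> \<le> (\<integral>y. B y \<partial>P)"
    using f g by (intro integral_mono B le) auto
  finally have 2: "\<bar>\<integral>y. f y - g y \<partial>P\<bar> \<le> (\<integral>y. B y \<partial>P)" .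
  have "\<bar>empirical_process P n x (\<lambda>y. f y - g y)\<bar>
      = sqrt (real n) * \<bar>(\<Sum>i<n. f (x i) - g (x i)) / real n - (\<integral>y. f y - g y \<partial>P)\<bar>"
    by (simp add: empirical_process_def abs_mult)
  also have "\<dots> \<le> sqrt (real n) * ((\<Sum>i<n. B (x i)) / real n + (\<integral>y. B y \<partial>P))"
  proof (rule mult_left_mono)
    show "\<bar>(\<Sum>i<n. f (x i) - g (x i)) / real n - (\<integral>y. f y - g y \<partial>P)\<bar>
      \<le> (\<Sum>i<n. B (x i)) / real n + (\<integral>y. B y \<partial>P)"
      using 1 2 by (rule order_trans[OF abs_triangle_ineq4 add_mono])
  qed simp
  also have "\<dots> = empirical_process P n x B + 2 * (sqrt (real n) * (\<integral>y. B y \<partial>P))"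
    by (simp add: empirical_process_def algebra_simps)
  finally show ?thesis
    by (simp add: empirical_process_diff f g)
qed

text \<open>\<open>(x - \<mu>) / \<sigma>\<close> is monotone in \<open>\<mu>\<close> and in \<open>\<sigma>\<close> separately, so its extrema over a box are
  attained at corners.\<close>

lemma G_ls_corner_bound:
  assumes "mono G\<^sub>0" and "r > 0" and s: "s - r > 0"
    and \<mu>: "\<bar>\<mu> - a\<bar> \<le> r" and \<sigma>: "\<bar>\<sigma> - s\<bar> \<le> r"
  shows "\<bar>G_ls G\<^sub>0 (\<mu>, \<sigma>) x - y\<bar> \<le> (\<Sum>p\<in>{-r, r} \<times> {-r, r}. \<bar>G_ls G\<^sub>0 ((a, s) + p) x - y\<bar>)"
proof -
  have pos: "s - r > 0" "s + r > 0" "\<sigma> > 0" using s \<sigma> \<open>r > 0\<close> by auto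
  have corner: "\<bar>G_ls G\<^sub>0 ((a, s) + p) x - y\<bar> \<le> (\<Sum>p\<in>{-r, r} \<times> {-r, r}. \<bar>G_ls G\<^sub>0 ((a, s) + p) x - y\<bar>)"
    if "p \<in> {-r, r} \<times> {-r, r}" for p
    using that by (intro member_le_sum) auto
  have mono: "G_ls G\<^sub>0 \<theta> x \<le> G_ls G\<^sub>0 \<theta>' x" if "(x - fst \<theta>) / snd \<theta> \<le> (x - fst \<theta>') / snd \<theta>'" for \<theta> \<theta>'
    unfolding G_ls_def using \<open>mono G\<^sub>0\<close> that by (rule monoD)
  have "\<exists>p\<in>{-r, r} \<times> {-r, r}. G_ls G\<^sub>0 (\<mu>, \<sigma>) x \<le> G_ls G\<^sub>0 ((a, s) + p) x"
  \<comment> \<open>The smallest location maximizes the numerator. Shrinking the scale raises a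
    nonnegative quotient and lowers a negative one, so the sign of the numerator decides the second
    coordinate of the corner. The lower bound below is the mirror image.\<close>
  proof (cases "x - (a - r) \<ge> 0")
    case True
    have "(x - \<mu>) / \<sigma> \<le> (x - (a - r)) / \<sigma>" using \<mu> pos by (intro divide_right_mono) auto
    also have "\<dots> \<le> (x - (a - r)) / (s - r)" using True \<sigma> pos by (intro divide_left_mono) auto
    finally show ?thesis by (intro bexI[of _ "(-r, -r)"] mono) (auto simp: algebra_simps)
  next
    case False
    have "(x - \<mu>) / \<sigma> \<le> (x - (a - r)) / \<sigma>" using \<mu> pos by (intro divide_right_mono) auto
    also have "\<dots> \<le> (x - (a - r)) / (s + r)" using False \<sigma> pos by (intro divide_left_mono_neg) auto
    finally show ?thesis by (intro bexI[of _ "(-r, r)"] mono) (auto simp: algebra_simps)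
  qed
  moreover have "\<exists>p\<in>{-r, r} \<times> {-r, r}. G_ls G\<^sub>0 ((a, s) + p) x \<le> G_ls G\<^sub>0 (\<mu>, \<sigma>) x"
  proof (cases "x - (a + r) \<ge> 0")
    case True
    have "(x - (a + r)) / (s + r) \<le> (x - (a + r)) / \<sigma>" using True \<sigma> pos by (intro divide_left_mono) auto
    also have "\<dots> \<le> (x - \<mu>) / \<sigma>" using \<mu> pos by (intro divide_right_mono) auto
    finally show ?thesis by (intro bexI[of _ "(r, r)"] mono) (auto simp: algebra_simps)
  next
    case False
    have "(x - (a + r)) / (s - r) \<le> (x - (a + r)) / \<sigma>" using False \<sigma> pos by (intro divide_left_mono_neg) auto
    also have "\<dots> \<le> (x - \<mu>) / \<sigma>" using \<mu> pos by (intro divide_right_mono) auto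
    finally show ?thesis by (intro bexI[of _ "(r, -r)"] mono) (auto simp: algebra_simps)
  qed
  \<comment> \<open>The value lies between two corner values, so its distance to \<open>y\<close> is
    at most the larger of their distances, hence at most the sum over all corners.\<close>
  ultimately show ?thesis using corner by (smt (verit, best))
qed

section \<open>First-moment estimates for the location-scale family near the true parameter\<close>

locale location_scale_sample = iid_sample M X P
  for M :: "'w measure" and X :: "nat \<Rightarrow> 'w \<Rightarrow> real" and P :: "real measure" +
  fixes G\<^sub>0 :: "real \<Rightarrow> real" and \<theta>\<^sub>0 :: "real \<times> real"
  assumes G0_cont: "continuous_on UNIV G\<^sub>0"
    and G0_mono: "strict_mono G\<^sub>0"
    and G0_bij: "bij_betw G\<^sub>0 UNIV {0<..<1}"
    and scale_pos: "snd \<theta>\<^sub>0 > 0"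
    and G_L2_diff: "L2_differentiable P (G_ls G\<^sub>0) \<theta>\<^sub>0"
begin

lemma G0_range: "G\<^sub>0 z \<in> {0<..<1}"
  using bij_betw_apply[OF G0_bij, of z] by simp

lemma G_ls_range: "G_ls G\<^sub>0 \<theta> x > 0" "G_ls G\<^sub>0 \<theta> x < 1"
  using G0_range by (auto simp: G_ls_def)

lemma G_ls_diff_le_1: "\<bar>G_ls G\<^sub>0 \<theta> x - G_ls G\<^sub>0 \<theta>' x\<bar> \<le> 1"
  using G_ls_range[of \<theta> x] G_ls_range[of \<theta>' x] by (simp add: abs_le_iff)

lemma G0_measurable[measurable]: "G\<^sub>0 \<in> borel_measurable borel"
  by (rule borel_measurable_continuous_onI[OF G0_cont])

lemma G_ls_measurable[measurable]: "G_ls G\<^sub>0 \<theta> \<in> borel_measurable borel"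
  unfolding G_ls_def[abs_def] by measurable

lemma G_ls_measurable_pair[measurable (raw)]:
  assumes [measurable]: "t \<in> borel_measurable N" "f \<in> borel_measurable N"
  shows "(\<lambda>\<omega>. G_ls G\<^sub>0 (t \<omega>) (f \<omega>)) \<in> borel_measurable N"
proof -
  have [measurable]: "t \<in> measurable N (borel \<Otimes>\<^sub>M borel)"
    using assms(1) by (simp add: borel_prod)
  show ?thesis unfolding G_ls_def[abs_def] by measurable
qed

lemma G_ls_integrable: "integrable P (G_ls G\<^sub>0 \<theta>)"
  using G_ls_range[of \<theta>] by (intro P.integrable_const_bound[where B = 1]) (auto simp: less_imp_le abs_of_pos)

lemma m_ls_measurable[measurable]: "m_ls G\<^sub>0 P \<in> borel_measurable borel"
  unfolding m_ls_def[abs_def] by (rule P.borel_measurable_lebesgue_integral) measurable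

text \<open>The inverse of \<open>h = sqrt n (\<theta> - \<theta>\<^sub>0)\<close>, the coordinate
  in which the estimator is bounded in probability.\<close>

definition local_param :: "nat \<Rightarrow> real \<times> real \<Rightarrow> real \<times> real"
  where "local_param n h = \<theta>\<^sub>0 + (1 / sqrt (real n)) *\<^sub>R h"

lemma integrable_G_diff: "integrable P (\<lambda>x. \<bar>G_ls G\<^sub>0 \<theta> x - G_ls G\<^sub>0 \<theta>' x\<bar>)"
  using G_ls_integrable by (intro integrable_abs Bochner_Integration.integrable_diff)

text \<open>Subtracting the expansions of both parameters around \<open>\<theta>\<^sub>0\<close>
  leaves the derivative \<open>D\<close> applied to their difference, plus two remainders that are
  \<open>o(1 / sqrt n)\<close> for fixed \<open>h\<close> and \<open>h'\<close>. The constant is the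
  mean of \<open>norm D\<close>; being independent of \<open>h\<close>, \<open>h'\<close> and
  \<open>e\<close>, it can enter the choice of the box size.\<close>

lemma local_L1_bound:
  "\<exists>A\<ge>0. \<forall>h h'. \<forall>e>0. \<forall>\<^sub>F n in sequentially.
    sqrt (real n) * (\<integral>x. \<bar>G_ls G\<^sub>0 (local_param n h) x - G_ls G\<^sub>0 (local_param n h') x\<bar> \<partial>P)
      \<le> A * norm (h - h') + e"
proof -
  obtain D where D[measurable]: "D \<in> borel_measurable P"
    and D_sq: "integrable P (\<lambda>x. (norm (D x))\<^sup>2)"
    and small: "(\<lambda>\<theta>. L2_norm P (\<lambda>x. G_ls G\<^sub>0 \<theta> x - G_ls G\<^sub>0 \<theta>\<^sub>0 x - (\<theta> - \<theta>\<^sub>0) \<bullet> D x))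
      \<in> o[at \<theta>\<^sub>0](\<lambda>\<theta>. norm (\<theta> - \<theta>\<^sub>0))"
    using G_L2_diff unfolding L2_differentiable_def by blast
  have D_int: "integrable P (\<lambda>x. norm (D x))"
    by (rule P.square_integrable_imp_integrable[OF _ D_sq]) simp
  define R where "R \<theta> x = G_ls G\<^sub>0 \<theta> x - G_ls G\<^sub>0 \<theta>\<^sub>0 x - (\<theta> - \<theta>\<^sub>0) \<bullet> D x" for \<theta> x
  have R_measurable[measurable]: "R \<theta> \<in> borel_measurable P" for \<theta>
    unfolding R_def[abs_def] by measurable
  \<comment> \<open>\<open>L2_norm\<close> is built on an integral that defaults to 0, so its
    smallness controls \<open>R\<close> only once the square is known to be integrable.\<close>
  have R_sq: "integrable P (\<lambda>x. (R \<theta> x)\<^sup>2)" for \<theta>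
  proof (rule Bochner_Integration.integrable_bound)
    show "integrable P (\<lambda>x. 2 + 2 * (norm (\<theta> - \<theta>\<^sub>0))\<^sup>2 * (norm (D x))\<^sup>2)"
      using D_sq by simp
    have "norm ((R \<theta> x)\<^sup>2) \<le> norm (2 + 2 * (norm (\<theta> - \<theta>\<^sub>0))\<^sup>2 * (norm (D x))\<^sup>2)" for x
    proof -
      let ?a = "G_ls G\<^sub>0 \<theta> x - G_ls G\<^sub>0 \<theta>\<^sub>0 x" and ?b = "(\<theta> - \<theta>\<^sub>0) \<bullet> D x"
      have "(a - b)\<^sup>2 \<le> 2 * a\<^sup>2 + 2 * b\<^sup>2" for a b :: real
        using zero_le_power2[of "a + b"] by (simp add: power2_sum power2_diff)
      then have "(?a - ?b)\<^sup>2 \<le> 2 * ?a\<^sup>2 + 2 * ?b\<^sup>2" .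
      moreover have "?a\<^sup>2 \<le> 1" using G_ls_diff_le_1[of \<theta> x \<theta>\<^sub>0] by (simp add: abs_square_le_1)
      moreover have "?b\<^sup>2 \<le> (norm (\<theta> - \<theta>\<^sub>0))\<^sup>2 * (norm (D x))\<^sup>2"
        using power_mono[OF Cauchy_Schwarz_ineq2[of "\<theta> - \<theta>\<^sub>0" "D x"], of 2]
        by (simp add: power_mult_distrib)
      ultimately have "(?a - ?b)\<^sup>2 \<le> 2 + 2 * ((norm (\<theta> - \<theta>\<^sub>0))\<^sup>2 * (norm (D x))\<^sup>2)" by linarith
      then show ?thesis by (simp add: R_def mult.assoc)
    qed
    then show "AE x in P. norm ((R \<theta> x)\<^sup>2) \<le> norm (2 + 2 * (norm (\<theta> - \<theta>\<^sub>0))\<^sup>2 * (norm (D x))\<^sup>2)"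
      by simp
  qed simp
  have R_int: "integrable P (R \<theta>)" for \<theta>
    by (rule P.square_integrable_imp_integrable[OF _ R_sq]) simp
  have R_small: "\<forall>\<^sub>F n in sequentially. sqrt (real n) * (\<integral>x. \<bar>R (local_param n h) x\<bar> \<partial>P) \<le> e"
    if "e > 0" for h e
  \<comment> \<open>The little-o bound lives on the punctured neighbourhood of
    \<open>\<theta>\<^sub>0\<close>; for \<open>h = 0\<close> the local parameter is
    \<open>\<theta>\<^sub>0\<close> itself and the remainder is 0.\<close>
  proof (cases "h = 0")
    case True
    then show ?thesis using \<open>e > 0\<close> by (simp add: R_def local_param_def)
  next
    case False
    have "(\<lambda>n. local_param n h) \<longlonglongrightarrow> \<theta>\<^sub>0 + 0 *\<^sub>R h"
      unfolding local_param_def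
      by (intro tendsto_intros tendsto_divide_0[OF tendsto_const] filterlim_at_top_imp_at_infinity
          filterlim_compose[OF sqrt_at_top] filterlim_real_sequentially)
    moreover have "\<forall>\<^sub>F n in sequentially. local_param n h \<noteq> \<theta>\<^sub>0"
      using eventually_gt_at_top[of 0] by eventually_elim (simp add: local_param_def False)
    ultimately have "filterlim (\<lambda>n. local_param n h) (at \<theta>\<^sub>0) sequentially"
      by (simp add: filterlim_at)
    \<comment> \<open>The local parameter lies at distance \<open>norm h / sqrt n\<close> from
      \<open>\<theta>\<^sub>0\<close>, so the factor \<open>e / norm h\<close> yields exactly
      \<open>e / sqrt n\<close>.\<close>
    moreover have "\<forall>\<^sub>F \<theta> in at \<theta>\<^sub>0. norm (L2_norm P (R \<theta>)) \<le> e / norm h * norm (norm (\<theta> - \<theta>\<^sub>0))"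
      unfolding R_def using False \<open>e > 0\<close> by (intro landau_o.smallD[OF small]) simp
    ultimately have "\<forall>\<^sub>F n in sequentially.
        norm (L2_norm P (R (local_param n h))) \<le> e / norm h * norm (norm (local_param n h - \<theta>\<^sub>0))"
      by (rule eventually_compose_filterlim[rotated])
    with eventually_gt_at_top[of 0] show ?thesis
    proof eventually_elim
      case (elim n)
      have "(\<integral>x. \<bar>R (local_param n h) x\<bar> \<partial>P) \<le> L2_norm P (R (local_param n h))"
        by (rule P.expectation_abs_le_L2_norm[OF _ R_sq]) simp
      also have "\<dots> \<le> e / norm h * norm (local_param n h - \<theta>\<^sub>0)" using elim by simp
      also have "\<dots> = e / sqrt (real n)" using False elim by (simp add: local_param_def)
      finally show ?case using elim by (simp add: field_simps)
    qed
  qed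
  define A where "A = (\<integral>x. norm (D x) \<partial>P)"
  show ?thesis
  proof (intro exI[of _ A] conjI allI impI)
    show "A \<ge> 0" by (simp add: A_def)
    fix h h' and e :: real assume "e > 0"
    then have "\<forall>\<^sub>F n in sequentially. sqrt (real n) * (\<integral>x. \<bar>R (local_param n h) x\<bar> \<partial>P) \<le> e / 2"
      "\<forall>\<^sub>F n in sequentially. sqrt (real n) * (\<integral>x. \<bar>R (local_param n h') x\<bar> \<partial>P) \<le> e / 2"
      using R_small[of "e / 2" h] R_small[of "e / 2" h'] by simp_all
    with eventually_gt_at_top[of 0] show "\<forall>\<^sub>F n in sequentially.
      sqrt (real n) * (\<integral>x. \<bar>G_ls G\<^sub>0 (local_param n h) x - G_ls G\<^sub>0 (local_param n h') x\<bar> \<partial>P)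
        \<le> A * norm (h - h') + e"
    proof eventually_elim
      case (elim n)
      let ?p = "local_param n h" and ?q = "local_param n h'"
      have pq: "?p - ?q = (1 / sqrt (real n)) *\<^sub>R (h - h')"
        by (simp add: local_param_def scaleR_diff_right)
      have "(\<integral>x. \<bar>G_ls G\<^sub>0 ?p x - G_ls G\<^sub>0 ?q x\<bar> \<partial>P)
          \<le> (\<integral>x. \<bar>R ?p x\<bar> + \<bar>R ?q x\<bar> + norm (?p - ?q) * norm (D x) \<partial>P)"
      proof (rule integral_mono[OF integrable_G_diff])
        show "integrable P (\<lambda>x. \<bar>R ?p x\<bar> + \<bar>R ?q x\<bar> + norm (?p - ?q) * norm (D x))"
          using R_int D_int by simp
        fix x
        have "G_ls G\<^sub>0 ?p x - G_ls G\<^sub>0 ?q x = R ?p x - R ?q x + (?p - ?q) \<bullet> D x"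
          by (simp add: R_def inner_diff_left)
        then show "\<bar>G_ls G\<^sub>0 ?p x - G_ls G\<^sub>0 ?q x\<bar> \<le> \<bar>R ?p x\<bar> + \<bar>R ?q x\<bar> + norm (?p - ?q) * norm (D x)"
          using Cauchy_Schwarz_ineq2[of "?p - ?q" "D x"] by linarith
      qed
      also have "\<dots> = (\<integral>x. \<bar>R ?p x\<bar> \<partial>P) + (\<integral>x. \<bar>R ?q x\<bar> \<partial>P) + norm (?p - ?q) * A"
        using R_int D_int by (simp add: A_def)
      finally have "sqrt (real n) * (\<integral>x. \<bar>G_ls G\<^sub>0 ?p x - G_ls G\<^sub>0 ?q x\<bar> \<partial>P)
        \<le> sqrt (real n) * ((\<integral>x. \<bar>R ?p x\<bar> \<partial>P) + (\<integral>x. \<bar>R ?q x\<bar> \<partial>P) + norm (?p - ?q) * A)"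
        by (intro mult_left_mono) auto
      also have "\<dots> = sqrt (real n) * (\<integral>x. \<bar>R ?p x\<bar> \<partial>P) + sqrt (real n) * (\<integral>x. \<bar>R ?q x\<bar> \<partial>P)
          + A * norm (h - h')"
        using elim by (simp add: pq distrib_left)
      finally show ?case using elim by linarith
    qed
  qed
qed

lemma local_L1_tendsto_0:
  "(\<lambda>n. \<integral>x. \<bar>G_ls G\<^sub>0 (local_param n h) x - G_ls G\<^sub>0 (local_param n h') x\<bar> \<partial>P) \<longlonglongrightarrow> 0"
proof -
  obtain A where bound: "\<forall>h h'. \<forall>e>0. \<forall>\<^sub>F n in sequentially.
    sqrt (real n) * (\<integral>x. \<bar>G_ls G\<^sub>0 (local_param n h) x - G_ls G\<^sub>0 (local_param n h') x\<bar> \<partial>P)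
      \<le> A * norm (h - h') + e"
    using local_L1_bound by blast
  have "\<forall>\<^sub>F n in sequentially.
    (\<integral>x. \<bar>G_ls G\<^sub>0 (local_param n h) x - G_ls G\<^sub>0 (local_param n h') x\<bar> \<partial>P)
      \<le> (A * norm (h - h') + 1) / sqrt (real n)"
    using bound[rule_format, OF zero_less_one, of h h'] eventually_gt_at_top[of 0]
    by eventually_elim (simp add: field_simps)
  moreover have lim: "(\<lambda>n. (A * norm (h - h') + 1) / sqrt (real n)) \<longlonglongrightarrow> 0"
    by (intro tendsto_divide_0[OF tendsto_const] filterlim_at_top_imp_at_infinity
          filterlim_compose[OF sqrt_at_top] filterlim_real_sequentially)
  ultimately show ?thesis
    by (intro real_tendsto_sandwich[OF _ _ tendsto_const lim]) auto
qed

section \<open>Box envelopes and equicontinuity at the estimated parameter\<close>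

lemma corner_dist: "p \<in> {-r, r} \<times> {-r, r} \<Longrightarrow> norm p \<le> 2 * \<bar>r\<bar>" for r :: real
  using norm_Pair_le[of "fst p" "snd p"] by auto

lemma empirical_process_measurable:
  assumes [measurable]: "\<And>n. t n \<in> borel_measurable M"
  shows "(\<lambda>\<omega>. empirical_process P n (\<lambda>i. X i \<omega>) (G_ls G\<^sub>0 (t n \<omega>))) \<in> borel_measurable M"
proof -
  have "empirical_process P n (\<lambda>i. X i \<omega>) (G_ls G\<^sub>0 (t n \<omega>))
    = sqrt (real n) * ((\<Sum>i<n. G_ls G\<^sub>0 (t n \<omega>) (X i \<omega>)) / real n - m_ls G\<^sub>0 P (t n \<omega>))" for \<omega>
    by (simp add: empirical_process_def m_ls_def)
  then show ?thesis by simp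
qed

text \<open>Deviations of the four corners from the centre of a box with half-side \<open>r\<close>
  in local coordinates. The sum replaces the maximum so that the mean splits into terms covered by
  \<open>local_L1_bound\<close>.\<close>

definition envelope :: "real \<Rightarrow> nat \<Rightarrow> real \<times> real \<Rightarrow> real \<Rightarrow> real"
  where "envelope r n c x = (\<Sum>p\<in>{-r, r} \<times> {-r, r}.
    \<bar>G_ls G\<^sub>0 (local_param n (c + p)) x - G_ls G\<^sub>0 (local_param n c) x\<bar>)"

lemma envelope_measurable[measurable]: "envelope r n c \<in> borel_measurable borel"
  unfolding envelope_def[abs_def] by measurable

lemma envelope_bounds: "0 \<le> envelope r n c x" "envelope r n c x \<le> 4"
proof -
  show "0 \<le> envelope r n c x" unfolding envelope_def by (intro sum_nonneg) simp
  have "envelope r n c x \<le> (\<Sum>p\<in>{-r, r} \<times> {-r, r}. 1)"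
    unfolding envelope_def by (intro sum_mono G_ls_diff_le_1)
  also have "\<dots> \<le> 4"
  proof -
    \<comment> \<open>Only an inequality, since \<open>r\<close> is arbitrary here and the corners
      coincide for \<open>r = 0\<close>.\<close>
    have "card ({-r, r} \<times> {-r, r}) \<le> 2 * 2"
      unfolding card_cartesian_product by (intro mult_le_mono) (simp_all add: card_insert_if)
    then show ?thesis by simp
  qed
  finally show "envelope r n c x \<le> 4" .
qed

lemma integrable_envelope: "integrable P (envelope r n c)"
  unfolding envelope_def[abs_def] by (intro Bochner_Integration.integrable_sum integrable_G_diff)

lemma integral_envelope: "(\<integral>x. envelope r n c x \<partial>P) = (\<Sum>p\<in>{-r, r} \<times> {-r, r}.
    \<integral>x. \<bar>G_ls G\<^sub>0 (local_param n (c + p)) x - G_ls G\<^sub>0 (local_param n c) x\<bar> \<partial>P)"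
  unfolding envelope_def by (intro Bochner_Integration.integral_sum integrable_G_diff)

text \<open>For functions bounded by \<open>K\<close>,
  \<open>f\<^sup>2 \<le> K * \<bar>f\<bar>\<close> turns convergence of first moments into the
  convergence of second moments that the Chebyshev argument requires.\<close>

lemma oP1_empirical_process_L1:
  assumes f[measurable]: "\<And>n. f n \<in> borel_measurable borel"
    and bound: "\<And>n x. \<bar>f n x\<bar> \<le> K"
    and lim: "(\<lambda>n. \<integral>x. \<bar>f n x\<bar> \<partial>P) \<longlonglongrightarrow> 0"
  shows "oP1 M (\<lambda>n \<omega>. empirical_process P n (\<lambda>i. X i \<omega>) (f n))"
proof (rule oP1_empirical_process[OF f])
  have sq: "(f n x)\<^sup>2 \<le> K * \<bar>f n x\<bar>" for n x
    using mult_right_mono[OF bound[of n x], of "\<bar>f n x\<bar>"] by (simp add: power2_eq_square)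
  have int: "integrable P (f n)" for n
    using bound by (intro P.integrable_const_bound[where B = K]) auto
  show int2: "integrable P (\<lambda>x. (f n x)\<^sup>2)" for n
    by (rule Bochner_Integration.integrable_bound[of P "\<lambda>x. K * \<bar>f n x\<bar>"])
      (use int sq in \<open>auto intro!: order_trans[OF sq abs_ge_self]\<close>)
  have "(\<integral>x. (f n x)\<^sup>2 \<partial>P) \<le> (\<integral>x. K * \<bar>f n x\<bar> \<partial>P)" for n
    using int by (intro integral_mono int2 sq) auto
  moreover have lim': "(\<lambda>n. \<integral>x. K * \<bar>f n x\<bar> \<partial>P) \<longlonglongrightarrow> 0"
    using tendsto_mult_left[OF lim, of K] by simp
  ultimately show "(\<lambda>n. \<integral>x. (f n x)\<^sup>2 \<partial>P) \<longlonglongrightarrow> 0"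
    by (intro real_tendsto_sandwich[OF _ _ tendsto_const lim']) auto
qed

lemma oP1_empirical_process_envelope:
  "oP1 M (\<lambda>n \<omega>. empirical_process P n (\<lambda>i. X i \<omega>) (envelope r n c))"
proof (rule oP1_empirical_process_L1)
  show "\<bar>envelope r n c x\<bar> \<le> 4" for n x using envelope_bounds by simp
  have "(\<lambda>n. \<integral>x. envelope r n c x \<partial>P) \<longlonglongrightarrow> (\<Sum>p\<in>{-r, r} \<times> {-r, r}. 0)"
    unfolding integral_envelope by (intro tendsto_sum local_L1_tendsto_0)
  then show "(\<lambda>n. \<integral>x. \<bar>envelope r n c x\<bar> \<partial>P) \<longlonglongrightarrow> 0"
    by (simp add: envelope_bounds abs_of_nonneg)
qed simp

lemma oP1_empirical_process_local:
  "oP1 M (\<lambda>n \<omega>. empirical_process P n (\<lambda>i. X i \<omega>) (G_ls G\<^sub>0 (local_param n c))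
    - empirical_process P n (\<lambda>i. X i \<omega>) (G_ls G\<^sub>0 \<theta>\<^sub>0))"
  unfolding empirical_process_diff[OF G_ls_integrable G_ls_integrable, symmetric]
proof (rule oP1_empirical_process_L1)
  show "(\<lambda>n. \<integral>x. \<bar>G_ls G\<^sub>0 (local_param n c) x - G_ls G\<^sub>0 \<theta>\<^sub>0 x\<bar> \<partial>P) \<longlonglongrightarrow> 0"
    using local_L1_tendsto_0[of c 0] by (simp add: local_param_def)
qed (measurable, rule G_ls_diff_le_1)

text \<open>In the original coordinates the box has half-side \<open>q = r / sqrt n\<close>, and
  \<open>pos\<close> says that its smallest scale is still positive, as the corner bound demands. A
  Euclidean ball of radius \<open>r\<close> fits into the box.\<close>

lemma envelope_bound:
  assumes "n > 0" "r > 0" and pos: "snd \<theta>\<^sub>0 + (snd c - r) / sqrt (real n) > 0" and h: "dist c h < r"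
  shows "\<bar>G_ls G\<^sub>0 (local_param n h) x - G_ls G\<^sub>0 (local_param n c) x\<bar> \<le> envelope r n c x"
proof -
  define q where "q = r / sqrt (real n)"
  have n: "sqrt (real n) > 0" using \<open>n > 0\<close> by simp
  have q: "q > 0" using \<open>r > 0\<close> n by (simp add: q_def)
  have scaled: "\<bar>(y - z) / sqrt (real n)\<bar> \<le> q" if "\<bar>y - z\<bar> < r" for y z
    unfolding q_def abs_divide using that by (intro frac_le) (use n in auto)
  have hc: "\<bar>fst h - fst c\<bar> < r" "\<bar>snd h - snd c\<bar> < r"
    using h dist_fst_le[of c h] dist_snd_le[of c h] by (auto simp: dist_real_def abs_minus_commute)
  have "\<bar>G_ls G\<^sub>0 (fst (local_param n h), snd (local_param n h)) x - G_ls G\<^sub>0 (local_param n c) x\<bar>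
    \<le> (\<Sum>p\<in>{-q, q} \<times> {-q, q}. \<bar>G_ls G\<^sub>0 ((fst (local_param n c), snd (local_param n c)) + p) x
        - G_ls G\<^sub>0 (local_param n c) x\<bar>)"
  proof (rule G_ls_corner_bound[OF strict_mono_mono[OF G0_mono] q])
    show "snd (local_param n c) - q > 0"
      using pos by (simp add: local_param_def q_def diff_divide_distrib)
    show "\<bar>fst (local_param n h) - fst (local_param n c)\<bar> \<le> q"
      using scaled[OF hc(1)] by (simp add: local_param_def diff_divide_distrib)
    show "\<bar>snd (local_param n h) - snd (local_param n c)\<bar> \<le> q"
      using scaled[OF hc(2)] by (simp add: local_param_def diff_divide_distrib)
  qed
  also have "\<dots> = envelope r n c x"
    unfolding envelope_def
  \<comment> \<open>Multiplication by \<open>sqrt n\<close> carries the corners at \<open>q\<close>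
    to the corners at \<open>r\<close>.\<close>
  proof (rule sum.reindex_bij_witness[where j = "\<lambda>p. sqrt (real n) *\<^sub>R p" and i = "\<lambda>p. (1 / sqrt (real n)) *\<^sub>R p"])
    show "\<bar>G_ls G\<^sub>0 (local_param n (c + sqrt (real n) *\<^sub>R p)) x - G_ls G\<^sub>0 (local_param n c) x\<bar> =
      \<bar>G_ls G\<^sub>0 ((fst (local_param n c), snd (local_param n c)) + p) x - G_ls G\<^sub>0 (local_param n c) x\<bar>" for p
      using n by (simp add: local_param_def scaleR_add_right add.assoc del: fst_add snd_add)
  qed (use n in \<open>auto simp: q_def\<close>)
  finally show ?thesis by simp
qed

text \<open>The order of choices matters: \<open>C\<close> depends on \<open>d\<close>,
  \<open>r\<close> on \<open>e\<close> and \<open>A\<close>, the finite cover \<open>E\<close> on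
  \<open>C\<close> and \<open>r\<close>. Only finitely many nonrandom processes are then left, and
  \<open>n\<close> may tend to infinity.\<close>

lemma empirical_process_equicontinuity:
  fixes t :: "nat \<Rightarrow> 'w \<Rightarrow> real \<times> real"
  assumes t[measurable]: "\<And>n. t n \<in> borel_measurable M"
    and bounded: "bounded_in_prob (\<lambda>n \<omega>. sqrt (real n) *\<^sub>R (t n \<omega> - \<theta>\<^sub>0))"
  shows "oP1 M (\<lambda>n \<omega>. empirical_process P n (\<lambda>i. X i \<omega>) (G_ls G\<^sub>0 (t n \<omega>))
    - empirical_process P n (\<lambda>i. X i \<omega>) (G_ls G\<^sub>0 \<theta>\<^sub>0))"
  unfolding oP1_iff_mostly
proof (intro conjI allI impI)
  let ?\<nu> = "\<lambda>n \<omega>. empirical_process P n (\<lambda>i. X i \<omega>)"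
  have meas[measurable]: "(\<lambda>\<omega>. ?\<nu> n \<omega> (G_ls G\<^sub>0 (t n \<omega>))) \<in> borel_measurable M" for n
    by (rule empirical_process_measurable) (rule t)
  have [measurable]: "(\<lambda>\<omega>. ?\<nu> n \<omega> (G_ls G\<^sub>0 \<theta>\<^sub>0)) \<in> borel_measurable M" for n
    by (rule empirical_process_measurable) simp
  show "(\<lambda>\<omega>. ?\<nu> n \<omega> (G_ls G\<^sub>0 (t n \<omega>)) - ?\<nu> n \<omega> (G_ls G\<^sub>0 \<theta>\<^sub>0)) \<in> borel_measurable M" for n
    by measurable
  fix e d :: real assume e: "e > 0" and d: "d > 0"
  define V where "V n \<omega> = sqrt (real n) *\<^sub>R (t n \<omega> - \<theta>\<^sub>0)" for n \<omega>
  obtain C where C: "mostly (d / 2) (\<lambda>n \<omega>. norm (V n \<omega>) \<le> C)"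
    using bounded d unfolding bounded_in_prob_def V_def by (meson half_gt_zero)
  obtain A where "A \<ge> 0" and A: "\<forall>h h'. \<forall>e>0. \<forall>\<^sub>F n in sequentially.
    sqrt (real n) * (\<integral>x. \<bar>G_ls G\<^sub>0 (local_param n h) x - G_ls G\<^sub>0 (local_param n h') x\<bar> \<partial>P)
      \<le> A * norm (h - h') + e"
    using local_L1_bound by blast
  \<comment> \<open>A corner has norm at most \<open>2 * r\<close>, so it contributes at most
    \<open>e / 48\<close> from the linear term and \<open>e / 48\<close> from the remainder. Four
    corners give \<open>e / 6\<close>, doubled to \<open>e / 3\<close> by
    \<open>empirical_process_diff_le\<close>; the envelope process and the move from the box centre
    to \<open>\<theta>\<^sub>0\<close> take the other two thirds.\<close>
  define r where "r = e / (96 * (A + 1))"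
  have "r > 0" using e \<open>A \<ge> 0\<close> by (simp add: r_def)
  have Ar: "A * (2 * r) + e / 48 \<le> e / 24"
    using e \<open>A \<ge> 0\<close> by (simp add: r_def field_simps)
  obtain E :: "(real \<times> real) set" where E: "finite E" "cball 0 C \<subseteq> (\<Union>c\<in>E. ball c r)"
    using compact_cball[THEN compact_eq_totally_bounded[THEN iffD1], THEN conjunct2, rule_format, OF \<open>r > 0\<close>]
    by metis
  have good: "mostly d (\<lambda>n \<omega>. norm (V n \<omega>) \<le> C \<and> (\<forall>c\<in>E. norm (?\<nu> n \<omega> (envelope r n c)) \<le> e / 3 \<and>
      norm (?\<nu> n \<omega> (G_ls G\<^sub>0 (local_param n c)) - ?\<nu> n \<omega> (G_ls G\<^sub>0 \<theta>\<^sub>0)) \<le> e / 3))"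
    using e d by (intro mostly_conj_half[OF C] mostly_ball_finite[OF E(1)] mostly_conj_half
        oP1D oP1_empirical_process_envelope oP1_empirical_process_local) auto
  have "\<forall>\<^sub>F n in sequentially. sqrt (real n) * (\<integral>x. envelope r n c x \<partial>P) \<le> e / 6" for c
  proof -
    have "\<forall>\<^sub>F n in sequentially. \<forall>p\<in>{-r, r} \<times> {-r, r}. sqrt (real n) *
      (\<integral>x. \<bar>G_ls G\<^sub>0 (local_param n (c + p)) x - G_ls G\<^sub>0 (local_param n c) x\<bar> \<partial>P) \<le> A * norm p + e / 48"
      using A[rule_format, of "e / 48" "c + p" c for p] e by (intro eventually_ball_finite) auto
    then show ?thesis
    proof eventually_elim
      case (elim n)
      have "sqrt (real n) * (\<integral>x. envelope r n c x \<partial>P) = (\<Sum>p\<in>{-r, r} \<times> {-r, r}. sqrt (real n) *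
      (\<integral>x. \<bar>G_ls G\<^sub>0 (local_param n (c + p)) x - G_ls G\<^sub>0 (local_param n c) x\<bar> \<partial>P))"
        by (simp only: integral_envelope sum_distrib_left)
      also have "\<dots> \<le> (\<Sum>p\<in>{-r, r} \<times> {-r, r}. e / 24)"
      proof (rule sum_mono)
        fix p assume p: "p \<in> {-r, r} \<times> {-r, r}"
        have "A * norm p \<le> A * (2 * r)"
          using corner_dist[OF p] \<open>A \<ge> 0\<close> \<open>r > 0\<close> by (intro mult_left_mono) auto
        then show "sqrt (real n) * (\<integral>x. \<bar>G_ls G\<^sub>0 (local_param n (c + p)) x
            - G_ls G\<^sub>0 (local_param n c) x\<bar> \<partial>P) \<le> e / 24"
          using elim p Ar by fastforce
      qed
      also have "\<dots> = e / 6"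
        using \<open>r > 0\<close> by (simp add: card_cartesian_product)
      finally show ?case .
    qed
  qed
  then have small: "\<forall>\<^sub>F n in sequentially. \<forall>c\<in>E. sqrt (real n) * (\<integral>x. envelope r n c x \<partial>P) \<le> e / 6"
    using E(1) by (intro eventually_ball_finite) auto
  have "\<forall>\<^sub>F n in sequentially. snd \<theta>\<^sub>0 + (snd c - r) / sqrt (real n) > 0" for c :: "real \<times> real"
  proof (rule order_tendstoD(1)[OF _ scale_pos])
    have "(\<lambda>n. snd \<theta>\<^sub>0 + (snd c - r) / sqrt (real n)) \<longlonglongrightarrow> snd \<theta>\<^sub>0 + 0"
      by (intro tendsto_intros tendsto_divide_0[OF tendsto_const] filterlim_at_top_imp_at_infinity
          filterlim_compose[OF sqrt_at_top] filterlim_real_sequentially)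
    then show "(\<lambda>n. snd \<theta>\<^sub>0 + (snd c - r) / sqrt (real n)) \<longlonglongrightarrow> snd \<theta>\<^sub>0" by simp
  qed
  then have pos: "\<forall>\<^sub>F n in sequentially. \<forall>c\<in>E. snd \<theta>\<^sub>0 + (snd c - r) / sqrt (real n) > 0"
    using E(1) by (intro eventually_ball_finite) auto
  show "mostly d (\<lambda>n \<omega>. norm (?\<nu> n \<omega> (G_ls G\<^sub>0 (t n \<omega>)) - ?\<nu> n \<omega> (G_ls G\<^sub>0 \<theta>\<^sub>0)) \<le> e)"
    using good
  proof (rule mostly_mono)
    show "\<forall>\<^sub>F n in sequentially. \<forall>\<omega>\<in>space M.
      norm (V n \<omega>) \<le> C \<and> (\<forall>c\<in>E. norm (?\<nu> n \<omega> (envelope r n c)) \<le> e / 3 \<and>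
        norm (?\<nu> n \<omega> (G_ls G\<^sub>0 (local_param n c)) - ?\<nu> n \<omega> (G_ls G\<^sub>0 \<theta>\<^sub>0)) \<le> e / 3) \<longrightarrow>
      norm (?\<nu> n \<omega> (G_ls G\<^sub>0 (t n \<omega>)) - ?\<nu> n \<omega> (G_ls G\<^sub>0 \<theta>\<^sub>0)) \<le> e"
      using eventually_gt_at_top[of 0] small pos
    proof (eventually_elim, intro ballI impI, elim conjE)
      fix n \<omega> assume "n > 0"
        and small: "\<forall>c\<in>E. sqrt (real n) * (\<integral>x. envelope r n c x \<partial>P) \<le> e / 6"
        and pos: "\<forall>c\<in>E. snd \<theta>\<^sub>0 + (snd c - r) / sqrt (real n) > 0"
        and V: "norm (V n \<omega>) \<le> C"
        and \<nu>: "\<forall>c\<in>E. norm (?\<nu> n \<omega> (envelope r n c)) \<le> e / 3 \<and>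
          norm (?\<nu> n \<omega> (G_ls G\<^sub>0 (local_param n c)) - ?\<nu> n \<omega> (G_ls G\<^sub>0 \<theta>\<^sub>0)) \<le> e / 3"
      have "V n \<omega> \<in> (\<Union>c\<in>E. ball c r)"
        using V by (intro subsetD[OF E(2)]) simp
      then obtain c where c: "c \<in> E" "dist c (V n \<omega>) < r"
        by (elim UN_E) (simp add: mem_ball)
      have tV: "t n \<omega> = local_param n (V n \<omega>)"
        using \<open>n > 0\<close> by (simp add: local_param_def V_def)
      have "\<bar>?\<nu> n \<omega> (G_ls G\<^sub>0 (t n \<omega>)) - ?\<nu> n \<omega> (G_ls G\<^sub>0 (local_param n c))\<bar>
        \<le> ?\<nu> n \<omega> (envelope r n c) + 2 * (sqrt (real n) * (\<integral>x. envelope r n c x \<partial>P))"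
        unfolding tV using envelope_bound[OF \<open>n > 0\<close> \<open>r > 0\<close> _ c(2)] pos c(1)
        by (intro empirical_process_diff_le G_ls_integrable integrable_envelope) auto
      moreover have "sqrt (real n) * (\<integral>x. envelope r n c x \<partial>P) \<le> e / 6" using small c(1) by blast
      moreover have "\<bar>?\<nu> n \<omega> (envelope r n c)\<bar> \<le> e / 3"
        "\<bar>?\<nu> n \<omega> (G_ls G\<^sub>0 (local_param n c)) - ?\<nu> n \<omega> (G_ls G\<^sub>0 \<theta>\<^sub>0)\<bar> \<le> e / 3"
        using \<nu> c(1) by auto
      ultimately show "norm (?\<nu> n \<omega> (G_ls G\<^sub>0 (t n \<omega>)) - ?\<nu> n \<omega> (G_ls G\<^sub>0 \<theta>\<^sub>0)) \<le> e"
        unfolding real_norm_def by linarith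
    qed
  qed
qed

subsection \<open>The quantile map and the estimator\<close>

lemma G0_inv_left: "inv G\<^sub>0 (G\<^sub>0 z) = z"
  using strict_mono_imp_inj_on[OF G0_mono] by simp

lemma G0_inv_right: "y \<in> {0<..<1} \<Longrightarrow> G\<^sub>0 (inv G\<^sub>0 y) = y"
  using G0_bij by (intro f_inv_into_f) (simp add: bij_betw_def)

lemma isCont_inv_G0:
  assumes "y \<in> {0<..<1}"
  shows "isCont (inv G\<^sub>0) y"
proof -
  have "isCont (inv G\<^sub>0) (G\<^sub>0 (inv G\<^sub>0 y))"
    using G0_cont by (intro isCont_inverse_function[where f = G\<^sub>0, OF zero_less_one])
      (simp_all add: G0_inv_left continuous_on_eq_continuous_at)
  then show ?thesis using assms by (simp add: G0_inv_right)
qed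

text \<open>Values outside the open unit interval have no preimage, so there \<open>inv\<close>
  returns one fixed choice from an empty predicate; inside, the inverse is continuous.\<close>

lemma inv_G0_measurable: "inv G\<^sub>0 \<in> borel_measurable borel"
proof -
  have "inv G\<^sub>0 = (\<lambda>y. if y \<in> {0<..<1} then inv G\<^sub>0 y else (SOME x. False))"
  proof
    fix y
    have "G\<^sub>0 x \<noteq> y" if "y \<notin> {0<..<1}" for x using G0_range[of x] that by auto
    then show "inv G\<^sub>0 y = (if y \<in> {0<..<1} then inv G\<^sub>0 y else (SOME x. False))"
      by (cases "y \<in> {0<..<1}") (simp_all add: inv_into_def)
  qed
  also have "\<dots> \<in> borel_measurable borel"
    by (intro borel_measurable_continuous_on_if continuous_at_imp_continuous_on ballI isCont_inv_G0) auto
  finally show ?thesis .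
qed

text \<open>Negative scales are included because the estimator may leave the parameter space;
  \<open>G_ls\<close> is then decreasing but still injective.\<close>

lemma inv_G_ls:
  assumes "snd \<theta> \<noteq> 0" "y \<in> {0<..<1}"
  shows "inv (G_ls G\<^sub>0 \<theta>) y = fst \<theta> + snd \<theta> * inv G\<^sub>0 y"
proof (rule inv_f_eq)
  show "inj (G_ls G\<^sub>0 \<theta>)"
    using assms(1) strict_mono_eq[OF G0_mono] by (intro injI) (simp add: G_ls_def)
  show "G_ls G\<^sub>0 \<theta> (fst \<theta> + snd \<theta> * inv G\<^sub>0 y) = y"
    using assms G0_inv_right by (simp add: G_ls_def)
qed

lemma m_ls_range: "m_ls G\<^sub>0 P \<theta> \<in> {0<..<1}"
  unfolding m_ls_def using G_ls_range[of \<theta>]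
  by (auto intro!: P.expectation_less P.expectation_greater G_ls_integrable)

lemma m_hat_range:
  assumes "n > 0"
  shows "m_hat G\<^sub>0 n \<theta> x \<in> {0<..<1}"
proof -
  have "(\<Sum>i<n. 0) < (\<Sum>i<n. G_ls G\<^sub>0 \<theta> (x i))" "(\<Sum>i<n. G_ls G\<^sub>0 \<theta> (x i)) < (\<Sum>i<n. 1)"
    using assms by (intro sum_strict_mono; auto simp: G_ls_range)+
  then show ?thesis using assms by (simp add: m_hat_def)
qed

text \<open>For \<open>\<sigma> = 0\<close> division by zero makes \<open>G\<^sub>\<theta>\<close> the constant \<open>G\<^sub>0 0\<close>, and the value is the arbitrary
  one that \<open>inv\<close> picks.\<close>

definition quantile :: "(real \<times> real) \<times> real \<Rightarrow> real"
  where "quantile w = (if snd (fst w) = 0 then inv (\<lambda>_ :: real. G\<^sub>0 0) (G\<^sub>0 0)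
    else fst (fst w) + snd (fst w) * inv G\<^sub>0 (snd w))"

lemma b_ls_eq_quantile: "b_ls G\<^sub>0 P \<theta>\<^sub>0 = quantile (\<theta>\<^sub>0, m_ls G\<^sub>0 P \<theta>\<^sub>0)"
  using scale_pos m_ls_range by (simp add: b_ls_def quantile_def inv_G_ls)

text \<open>The identity covers every parameter value, inadmissible ones too, so the estimator is a
  measurable function of parameter and mean on the whole sample space. At scale 0 the sample mean is
  exactly \<open>G\<^sub>0 0\<close>, as the first branch of \<open>quantile\<close>
  expects.\<close>

lemma b_ad_eq_quantile:
  assumes "n > 0"
  shows "b_ad G\<^sub>0 n \<theta> x = quantile (\<theta>, m_hat G\<^sub>0 n \<theta> x)"
proof (cases "snd \<theta> = 0")
  case True
  then have "G_ls G\<^sub>0 \<theta> = (\<lambda>_. G\<^sub>0 0)" by (simp add: G_ls_def fun_eq_iff)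
  moreover from this have "m_hat G\<^sub>0 n \<theta> x = G\<^sub>0 0" using assms by (simp add: m_hat_def)
  ultimately show ?thesis using True by (simp add: b_ad_def quantile_def)
next
  case False
  then show ?thesis using m_hat_range[OF assms] by (simp add: b_ad_def quantile_def inv_G_ls)
qed

lemma m_hat_measurable:
  assumes [measurable]: "t \<in> borel_measurable M"
  shows "(\<lambda>\<omega>. m_hat G\<^sub>0 n (t \<omega>) (\<lambda>i. X i \<omega>)) \<in> borel_measurable M"
  unfolding m_hat_def by measurable

lemma quantile_measurable:
  assumes "t \<in> borel_measurable M" and [measurable]: "f \<in> borel_measurable M"
  shows "(\<lambda>\<omega>. quantile (t \<omega>, f \<omega>)) \<in> borel_measurable M"
proof -
  have [measurable]: "t \<in> measurable M (borel \<Otimes>\<^sub>M borel)"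
    using assms(1) by (simp add: borel_prod)
  note [measurable] = inv_G0_measurable
  show ?thesis unfolding quantile_def by simp
qed

text \<open>Adding and subtracting \<open>m\<close> at the plugged-in parameter separates the
  sampling error, left to equicontinuity, from a smooth function of the parameter, left to the delta
  method.\<close>

lemma m_hat_decomposition:
  assumes "n > 0"
  shows "sqrt (real n) * (m_hat G\<^sub>0 n \<theta> x - m_ls G\<^sub>0 P \<theta>\<^sub>0)
    = empirical_process P n x (G_ls G\<^sub>0 \<theta>) + sqrt (real n) * (m_ls G\<^sub>0 P \<theta> - m_ls G\<^sub>0 P \<theta>\<^sub>0)"
  by (simp add: m_hat_def empirical_process_def m_ls_def algebra_simps)

section \<open>Derivatives of the family and of the quantile map at the truth\<close>

context
  fixes g :: real and b\<^sub>0 :: real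
  assumes b0_def: "b\<^sub>0 = b_ls G\<^sub>0 P \<theta>\<^sub>0"
    and g: "(G_ls G\<^sub>0 \<theta>\<^sub>0 has_real_derivative g) (at b\<^sub>0)" and g_pos: "g > 0"
begin

lemma standardized_b0: "(b\<^sub>0 - fst \<theta>\<^sub>0) / snd \<theta>\<^sub>0 = inv G\<^sub>0 (m_ls G\<^sub>0 P \<theta>\<^sub>0)"
  using scale_pos by (simp add: b0_def b_ls_eq_quantile quantile_def)

text \<open>\<open>G\<^sub>0\<close> is \<open>G_ls G\<^sub>0 \<theta>\<^sub>0\<close> after the
  affine map that undoes standardization; its slope supplies the factor
  \<open>snd \<theta>\<^sub>0\<close>.\<close>

lemma DERIV_G0: "(G\<^sub>0 has_real_derivative snd \<theta>\<^sub>0 * g) (at ((b\<^sub>0 - fst \<theta>\<^sub>0) / snd \<theta>\<^sub>0))"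
proof -
  let ?z = "(b\<^sub>0 - fst \<theta>\<^sub>0) / snd \<theta>\<^sub>0"
  have eq: "fst \<theta>\<^sub>0 + snd \<theta>\<^sub>0 * ?z = b\<^sub>0" using scale_pos by simp
  have "((\<lambda>z. G_ls G\<^sub>0 \<theta>\<^sub>0 (fst \<theta>\<^sub>0 + snd \<theta>\<^sub>0 * z)) has_real_derivative g * snd \<theta>\<^sub>0) (at ?z)"
    by (rule DERIV_chain2[of "G_ls G\<^sub>0 \<theta>\<^sub>0"]) (use g eq in \<open>auto intro!: derivative_eq_intros\<close>)
  moreover have "(\<lambda>z. G_ls G\<^sub>0 \<theta>\<^sub>0 (fst \<theta>\<^sub>0 + snd \<theta>\<^sub>0 * z)) = G\<^sub>0"
    using scale_pos by (simp add: G_ls_def fun_eq_iff)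
  ultimately show ?thesis by (simp add: mult.commute)
qed

lemma gradient_G_ls:
  "gradient (\<lambda>\<theta>. G_ls G\<^sub>0 \<theta> b\<^sub>0) \<theta>\<^sub>0 = (- g, - (g * inv G\<^sub>0 (m_ls G\<^sub>0 P \<theta>\<^sub>0)))"
proof (rule gradient_eqI)
  let ?z = "(b\<^sub>0 - fst \<theta>\<^sub>0) / snd \<theta>\<^sub>0"
  have s: "snd \<theta>\<^sub>0 \<noteq> 0" using scale_pos by simp
  have "((\<lambda>\<theta>. (b\<^sub>0 - fst \<theta>) / snd \<theta>) has_derivative
      (\<lambda>h. - fst h / snd \<theta>\<^sub>0 - ?z * snd h / snd \<theta>\<^sub>0)) (at \<theta>\<^sub>0)"
    using s by (auto intro!: derivative_eq_intros simp: fun_eq_iff field_simps)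
  from DERIV_compose_FDERIV[OF DERIV_G0 this]
  have "((\<lambda>\<theta>. G_ls G\<^sub>0 \<theta> b\<^sub>0) has_derivative
      (\<lambda>h. (- fst h / snd \<theta>\<^sub>0 - ?z * snd h / snd \<theta>\<^sub>0) * (snd \<theta>\<^sub>0 * g))) (at \<theta>\<^sub>0)"
    by (simp add: G_ls_def)
  also have "(\<lambda>h. (- fst h / snd \<theta>\<^sub>0 - ?z * snd h / snd \<theta>\<^sub>0) * (snd \<theta>\<^sub>0 * g)) = (\<lambda>h. h \<bullet> (- g, - (g * ?z)))"
    using s by (simp add: fun_eq_iff inner_prod_def field_simps)
  finally show "GDERIV (\<lambda>\<theta>. G_ls G\<^sub>0 \<theta> b\<^sub>0) \<theta>\<^sub>0 :> (- g, - (g * inv G\<^sub>0 (m_ls G\<^sub>0 P \<theta>\<^sub>0)))"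
    by (simp add: gderiv_def standardized_b0)
qed

text \<open>This is implicit differentiation of \<open>G_\<theta>(q) = y\<close>: the slope
  \<open>g\<close> times the change of \<open>q\<close>, plus the gradient in
  \<open>\<theta>\<close> applied to the change of \<open>\<theta>\<close>, equals the change of
  \<open>y\<close>.\<close>

lemma has_derivative_quantile:
  "(quantile has_derivative (\<lambda>w. (snd w - fst w \<bullet> gradient (\<lambda>\<theta>. G_ls G\<^sub>0 \<theta> b\<^sub>0) \<theta>\<^sub>0) / g))
    (at (\<theta>\<^sub>0, m_ls G\<^sub>0 P \<theta>\<^sub>0))" (is "(_ has_derivative ?D) _")
proof -
  let ?m = "m_ls G\<^sub>0 P \<theta>\<^sub>0"
  have s: "snd \<theta>\<^sub>0 \<noteq> 0" using scale_pos by simp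
  have "DERIV (inv G\<^sub>0) ?m :> inverse (snd \<theta>\<^sub>0 * g)"
  proof (rule DERIV_inverse_function)
    show "DERIV G\<^sub>0 (inv G\<^sub>0 ?m) :> snd \<theta>\<^sub>0 * g"
      using DERIV_G0 by (simp add: standardized_b0)
    show "0 < ?m" "?m < 1" using m_ls_range[of \<theta>\<^sub>0] by auto
  qed (use g_pos s m_ls_range[of \<theta>\<^sub>0] in \<open>auto intro!: G0_inv_right isCont_inv_G0\<close>)
  then have "((\<lambda>w. inv G\<^sub>0 (snd w)) has_derivative (\<lambda>w. snd w * inverse (snd \<theta>\<^sub>0 * g))) (at (\<theta>\<^sub>0, ?m))"
    by (intro DERIV_compose_FDERIV) (auto intro!: derivative_eq_intros)
  then have "((\<lambda>w. fst (fst w) + snd (fst w) * inv G\<^sub>0 (snd w)) has_derivative ?D) (at (\<theta>\<^sub>0, ?m))"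
    using s g_pos by (auto intro!: derivative_eq_intros simp: gradient_G_ls fun_eq_iff inner_prod_def field_simps)
  \<comment> \<open>The smooth formula agrees with \<open>quantile\<close> off scale 0 only, which
    is an open neighbourhood of the truth.\<close>
  moreover have "open {w :: (real \<times> real) \<times> real. snd (fst w) \<noteq> 0}"
    by (intro open_Collect_neq continuous_intros)
  ultimately show ?thesis
    by (rule has_derivative_transform_within_open) (use s in \<open>auto simp: quantile_def\<close>)
qed

end

text \<open>Two delta methods are chained. The one for \<open>m\<close> linearizes the sample mean
  to \<open>U\<close>; the one for \<open>quantile\<close> acts on parameter and mean jointly, since
  both are driven by the same sum \<open>S\<close>. Collecting the multiples of \<open>S\<close>
  produces \<open>Delta\<close>.\<close>

lemma b_ad_asymptotics:
  fixes t :: "nat \<Rightarrow> 'w \<Rightarrow> real \<times> real" and \<psi> :: "real \<Rightarrow> real \<times> real"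
  assumes t[measurable]: "\<And>n. t n \<in> borel_measurable M"
    and \<psi>[measurable]: "\<psi> \<in> borel_measurable borel"
    and \<psi>_sq: "integrable P (\<lambda>x. (norm (\<psi> x))\<^sup>2)"
    and \<psi>_mean: "(\<integral>x. \<psi> x \<partial>P) = 0"
    and expansion: "oP1 M (\<lambda>n \<omega>. sqrt (real n) *\<^sub>R (t n \<omega> - \<theta>\<^sub>0)
                   - (1 / sqrt (real n)) *\<^sub>R (\<Sum>i<n. \<psi> (X i \<omega>)))"
    and m_diff: "m_ls G\<^sub>0 P differentiable (at \<theta>\<^sub>0)"
    and G_diff: "G_ls G\<^sub>0 \<theta>\<^sub>0 differentiable (at (b_ls G\<^sub>0 P \<theta>\<^sub>0))"
    and G_deriv_pos: "deriv (G_ls G\<^sub>0 \<theta>\<^sub>0) (b_ls G\<^sub>0 P \<theta>\<^sub>0) > 0"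
  defines "Z \<equiv> \<lambda>n \<omega>. sqrt (real n) * (b_ad G\<^sub>0 n (t n \<omega>) (\<lambda>i. X i \<omega>) - b_ls G\<^sub>0 P \<theta>\<^sub>0)"
  shows "oP1 M (\<lambda>n \<omega>. Z n \<omega> - (1 / sqrt (real n)) * (\<Sum>i<n. IF_ad G\<^sub>0 P \<theta>\<^sub>0 \<psi> (X i \<omega>)))"
    and "weak_conv_m (\<lambda>n. distr M borel (Z n)) (normal_law 0 (\<integral>x. (IF_ad G\<^sub>0 P \<theta>\<^sub>0 \<psi> x)\<^sup>2 \<partial>P))"
proof -
  define b\<^sub>0 where "b\<^sub>0 = b_ls G\<^sub>0 P \<theta>\<^sub>0"
  define g where "g = deriv (G_ls G\<^sub>0 \<theta>\<^sub>0) b\<^sub>0"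
  define m\<^sub>0 where "m\<^sub>0 = m_ls G\<^sub>0 P \<theta>\<^sub>0"
  define Dm where "Dm = gradient (m_ls G\<^sub>0 P) \<theta>\<^sub>0"
  define DG where "DG = gradient (\<lambda>\<theta>. G_ls G\<^sub>0 \<theta> b\<^sub>0) \<theta>\<^sub>0"
  have g: "(G_ls G\<^sub>0 \<theta>\<^sub>0 has_real_derivative g) (at b\<^sub>0)" and g_pos: "g > 0"
    using G_diff G_deriv_pos
    by (auto simp: g_def b\<^sub>0_def DERIV_deriv_iff_real_differentiable)
  let ?IF = "IF_ad G\<^sub>0 P \<theta>\<^sub>0 \<psi>" and ?G = "\<lambda>x. G_ls G\<^sub>0 \<theta>\<^sub>0 x - m\<^sub>0"
  have IF_eq: "?IF x = (?G x + (Dm - DG) \<bullet> \<psi> x) / g" for x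
    by (simp add: IF_ad_def Delta_def Dm_def DG_def m\<^sub>0_def b\<^sub>0_def g_def)
  have IF_measurable[measurable]: "?IF \<in> borel_measurable borel"
    unfolding IF_eq[abs_def] by measurable
  have \<psi>_int: "integrable P \<psi>"
  proof -
    have "integrable P (\<lambda>x. norm (\<psi> x))"
      by (rule P.square_integrable_imp_integrable[OF _ \<psi>_sq]) simp
    then show ?thesis by (simp add: integrable_norm_iff)
  qed

  \<comment> \<open>The sum results are scalar, so the vector-valued \<open>\<psi>\<close> enters
    through projections: on the coordinate vectors to bound \<open>S\<close>, on gradients for the
    influence function.\<close>
  have \<psi>_comp: "bounded_in_prob (normed_sum (\<lambda>x. u \<bullet> \<psi> x))" "integrable P (\<lambda>x. (u \<bullet> \<psi> x)\<^sup>2)"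
    "(\<integral>x. u \<bullet> \<psi> x \<partial>P) = 0" for u
  proof -
    show sq: "integrable P (\<lambda>x. (u \<bullet> \<psi> x)\<^sup>2)"
    proof (rule Bochner_Integration.integrable_bound)
      show "integrable P (\<lambda>x. (norm u)\<^sup>2 * (norm (\<psi> x))\<^sup>2)" using \<psi>_sq by simp
      have "(u \<bullet> \<psi> x)\<^sup>2 \<le> (norm u)\<^sup>2 * (norm (\<psi> x))\<^sup>2" for x
        using power_mono[OF Cauchy_Schwarz_ineq2[of u "\<psi> x"], of 2]
        by (simp add: power_mult_distrib)
      then show "AE x in P. norm ((u \<bullet> \<psi> x)\<^sup>2) \<le> norm ((norm u)\<^sup>2 * (norm (\<psi> x))\<^sup>2)"
        by simp
    qed simp
    show mean: "(\<integral>x. u \<bullet> \<psi> x \<partial>P) = 0"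
      using \<psi>_int \<psi>_mean by simp
    show "bounded_in_prob (normed_sum (\<lambda>x. u \<bullet> \<psi> x))"
      by (rule bounded_in_prob_normed_sum[OF _ sq mean]) simp
  qed
  have G_sq: "integrable P (\<lambda>x. (G_ls G\<^sub>0 \<theta>\<^sub>0 x)\<^sup>2)"
    using G_ls_range[of \<theta>\<^sub>0]
    by (intro P.integrable_const_bound[where B = 1]) (auto simp: abs_square_le_1 less_imp_le abs_of_pos)
  note G_centered = square_integrable_centered[OF G_ls_measurable G_sq, folded m_ls_def, folded m\<^sub>0_def]
    mean_centered[OF G_ls_measurable G_sq, folded m_ls_def, folded m\<^sub>0_def]

  have IF_sq: "integrable P (\<lambda>x. (?IF x)\<^sup>2)"
  proof -
    have "integrable P (\<lambda>x. (?G x + (Dm - DG) \<bullet> \<psi> x)\<^sup>2)"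
    proof (rule Bochner_Integration.integrable_bound)
      show "integrable P (\<lambda>x. 2 * (?G x)\<^sup>2 + 2 * ((Dm - DG) \<bullet> \<psi> x)\<^sup>2)"
        using G_centered(1) \<psi>_comp(2) by simp
      have "(a + b)\<^sup>2 \<le> 2 * a\<^sup>2 + 2 * b\<^sup>2" for a b :: real
        using zero_le_power2[of "a - b"] by (simp add: power2_sum power2_diff)
      then show "AE x in P. norm ((?G x + (Dm - DG) \<bullet> \<psi> x)\<^sup>2)
          \<le> norm (2 * (?G x)\<^sup>2 + 2 * ((Dm - DG) \<bullet> \<psi> x)\<^sup>2)"
        by simp
    qed simp
    then show ?thesis unfolding IF_eq power_divide by simp
  qed
  have IF_mean: "(\<integral>x. ?IF x \<partial>P) = 0"
    using G_ls_integrable \<psi>_int \<psi>_comp(3) G_centered(2) unfolding IF_eq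
    by (simp add: Bochner_Integration.integral_add)

  define S where "S n \<omega> = (1 / sqrt (real n)) *\<^sub>R (\<Sum>i<n. \<psi> (X i \<omega>))" for n \<omega>
  have S_inner: "S n \<omega> \<bullet> u = normed_sum (\<lambda>x. u \<bullet> \<psi> x) n \<omega>" for n \<omega> u
    by (simp add: S_def normed_sum_def inner_sum_left inner_commute[of u])
  have "S = (\<lambda>n \<omega>. (normed_sum (\<lambda>x. (1, 0) \<bullet> \<psi> x) n \<omega>, normed_sum (\<lambda>x. (0, 1) \<bullet> \<psi> x) n \<omega>))"
    unfolding S_inner[symmetric] by (simp add: inner_prod_def)
  then have S_bounded: "bounded_in_prob S"
    using bounded_in_prob_Pair[OF \<psi>_comp(1)[of "(1, 0)"] \<psi>_comp(1)[of "(0, 1)"]] by simp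
  have expansion_S: "oP1 M (\<lambda>n \<omega>. sqrt (real n) *\<^sub>R (t n \<omega> - \<theta>\<^sub>0) - S n \<omega>)"
    using expansion by (simp add: S_def)
  have t_bounded: "bounded_in_prob (\<lambda>n \<omega>. sqrt (real n) *\<^sub>R (t n \<omega> - \<theta>\<^sub>0))"
    using bounded_in_prob_add[OF oP1_imp_bounded_in_prob[OF expansion_S] S_bounded] by simp

  \<comment> \<open>\<open>U\<close> collects the fluctuation at the true parameter and the
    first-order effect of estimating it.\<close>
  define U where "U n \<omega> = normed_sum ?G n \<omega> + S n \<omega> \<bullet> Dm" for n \<omega>
  let ?mh = "\<lambda>n \<omega>. m_hat G\<^sub>0 n (t n \<omega>) (\<lambda>i. X i \<omega>)"
  have U_bounded: "bounded_in_prob U"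
    unfolding U_def[abs_def] S_inner
    by (intro bounded_in_prob_add \<psi>_comp bounded_in_prob_normed_sum G_centered) simp
  have m_expansion: "oP1 M (\<lambda>n \<omega>. sqrt (real n) * (m_ls G\<^sub>0 P (t n \<omega>) - m\<^sub>0) - S n \<omega> \<bullet> Dm)"
    unfolding m\<^sub>0_def Dm_def
    by (rule delta_method[OF expansion_S S_bounded has_derivative_gradient[OF m_diff]]) simp
  have mh_expansion: "oP1 M (\<lambda>n \<omega>. sqrt (real n) *\<^sub>R (?mh n \<omega> - m\<^sub>0) - U n \<omega>)"
  proof (rule oP1_cong_eventually[OF oP1_add[OF empirical_process_equicontinuity[OF t t_bounded] m_expansion]])
    note [measurable] = m_hat_measurable bounded_in_prob_measurable[OF U_bounded]
    show "(\<lambda>\<omega>. sqrt (real n) *\<^sub>R (?mh n \<omega> - m\<^sub>0) - U n \<omega>) \<in> borel_measurable M" for n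
      by measurable
    show "\<forall>\<^sub>F n in sequentially. \<forall>\<omega>\<in>space M. sqrt (real n) *\<^sub>R (?mh n \<omega> - m\<^sub>0) - U n \<omega> =
        empirical_process P n (\<lambda>i. X i \<omega>) (G_ls G\<^sub>0 (t n \<omega>)) - empirical_process P n (\<lambda>i. X i \<omega>) (G_ls G\<^sub>0 \<theta>\<^sub>0)
        + (sqrt (real n) * (m_ls G\<^sub>0 P (t n \<omega>) - m\<^sub>0) - S n \<omega> \<bullet> Dm)"
      using eventually_gt_at_top[of 0]
    proof eventually_elim
      case (elim n)
      have "empirical_process P n (\<lambda>i. X i \<omega>) (G_ls G\<^sub>0 \<theta>\<^sub>0) = normed_sum ?G n \<omega>" for \<omega>
        by (simp add: empirical_process_eq_normed_sum m\<^sub>0_def m_ls_def)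
      then show ?case
        using m_hat_decomposition[OF elim] by (simp add: U_def m\<^sub>0_def)
    qed
  qed

  define W where "W n \<omega> = (t n \<omega>, ?mh n \<omega>)" for n \<omega>
  have W_expansion: "oP1 M (\<lambda>n \<omega>. sqrt (real n) *\<^sub>R (W n \<omega> - (\<theta>\<^sub>0, m\<^sub>0)) - (S n \<omega>, U n \<omega>))"
    using oP1_Pair[OF expansion_S mh_expansion] by (simp add: W_def)
  have qW[measurable]: "(\<lambda>\<omega>. quantile (W n \<omega>)) \<in> borel_measurable M" for n
    unfolding W_def by (intro quantile_measurable m_hat_measurable t)
  \<comment> \<open>The quantile form is available for \<open>n > 0\<close>; at \<open>n = 0\<close>
    the factor \<open>sqrt 0\<close> annihilates both sides.\<close>
  have Z_eq: "Z n \<omega> = sqrt (real n) * (quantile (W n \<omega>) - quantile (\<theta>\<^sub>0, m\<^sub>0))" for n \<omega>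
    by (cases "n = 0") (simp_all add: Z_def W_def b_ad_eq_quantile b_ls_eq_quantile m\<^sub>0_def)
  have Z_measurable[measurable]: "Z n \<in> borel_measurable M" for n
    unfolding Z_eq[abs_def] by measurable
  have IF_sum: "(U n \<omega> - S n \<omega> \<bullet> DG) / g = normed_sum ?IF n \<omega>" for n \<omega>
  proof -
    have "normed_sum ?IF n \<omega> = (normed_sum ?G n \<omega> + normed_sum (\<lambda>x. (Dm - DG) \<bullet> \<psi> x) n \<omega>) / g"
      by (simp add: normed_sum_def IF_eq sum_divide_distrib[symmetric] sum.distrib add_divide_distrib distrib_left)
    then show ?thesis
      by (simp add: U_def S_inner[symmetric] inner_diff_right)
  qed
  have main: "oP1 M (\<lambda>n \<omega>. Z n \<omega> - normed_sum ?IF n \<omega>)"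
    using delta_method[OF W_expansion bounded_in_prob_Pair[OF S_bounded U_bounded]
        has_derivative_quantile[OF b\<^sub>0_def g g_pos, folded m\<^sub>0_def DG_def] qW]
    by (simp add: Z_eq IF_sum)
  then show "oP1 M (\<lambda>n \<omega>. Z n \<omega> - (1 / sqrt (real n)) * (\<Sum>i<n. ?IF (X i \<omega>)))"
    by (simp add: normed_sum_def)
  show "weak_conv_m (\<lambda>n. distr M borel (Z n)) (normal_law 0 (\<integral>x. (?IF x)\<^sup>2 \<partial>P))"
    by (rule asymptotically_linear_imp_normal[OF IF_measurable IF_sq IF_mean Z_measurable main])
qed

end
theorem theorem5p4:
  fixes G\<^sub>0 g\<^sub>0 :: "real \<Rightarrow> real"
    and M :: "'w measure" and P :: "real measure"
    and X :: "nat \<Rightarrow> 'w \<Rightarrow> real"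
    and T :: "nat \<Rightarrow> (nat \<Rightarrow> real) \<Rightarrow> real \<times> real"
    and \<theta>_hat :: "nat \<Rightarrow> 'w \<Rightarrow> real \<times> real"
    and \<theta>\<^sub>0 :: "real \<times> real" and \<Theta>\<^sub>0 :: "(real \<times> real) set"
    and \<psi> :: "real \<Rightarrow> real \<times> real"
  assumes G0_cont: "continuous_on UNIV G\<^sub>0"
    and G0_mono: "strict_mono G\<^sub>0"
    and G0_bij: "bij_betw G\<^sub>0 UNIV {0<..<1}"
    and g0_integrable: "integrable lborel g\<^sub>0"
    and G0_density: "\<And>x. G\<^sub>0 x = (LBINT t:{..x}. g\<^sub>0 t)"
    and G0_deriv: "AE x in lborel. (G\<^sub>0 has_real_derivative g\<^sub>0 x) (at x)"
    and prob: "prob_space M"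
    and X_rv: "\<And>i. X i \<in> borel_measurable M"
    and X_indep: "prob_space.indep_vars M (\<lambda>_. borel) X UNIV"
    and X_law: "\<And>i. distr M borel (X i) = P"
    and T_meas: "\<And>n. T n \<in> borel_measurable (PiM {..<n} (\<lambda>_. borel))"
    and \<theta>_hat_eq: "\<And>n \<omega>. \<theta>_hat n \<omega> = T n (\<lambda>i\<in>{..<n}. X i \<omega>)"
    and \<theta>0_param: "\<theta>\<^sub>0 \<in> UNIV \<times> {0<..}"
    and \<theta>_hat_lim: "conv_in_prob M \<theta>_hat \<theta>\<^sub>0"
    and \<psi>_meas: "\<psi> \<in> borel_measurable borel"
    and \<psi>_sq: "integrable P (\<lambda>x. (norm (\<psi> x))\<^sup>2)"
    and \<psi>_mean: "(\<integral>x. \<psi> x \<partial>P) = 0"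
    and \<theta>_hat_expansion:
      "oP1 M (\<lambda>n \<omega>. sqrt (real n) *\<^sub>R (\<theta>_hat n \<omega> - \<theta>\<^sub>0)
                   - (1 / sqrt (real n)) *\<^sub>R (\<Sum>i<n. \<psi> (X i \<omega>)))"
    and \<Theta>0_param: "\<Theta>\<^sub>0 \<subseteq> UNIV \<times> {0<..}"
    and \<Theta>0_nhd: "\<theta>\<^sub>0 \<in> interior \<Theta>\<^sub>0"
    and G_donsker: "donsker P (G_ls G\<^sub>0 ` \<Theta>\<^sub>0)"
    and G_L2_diff: "L2_differentiable P (G_ls G\<^sub>0) \<theta>\<^sub>0"
    and m_diff: "m_ls G\<^sub>0 P differentiable (at \<theta>\<^sub>0)"
    and G_diff: "G_ls G\<^sub>0 \<theta>\<^sub>0 differentiable (at (b_ls G\<^sub>0 P \<theta>\<^sub>0))"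
    and G_deriv_pos: "deriv (G_ls G\<^sub>0 \<theta>\<^sub>0) (b_ls G\<^sub>0 P \<theta>\<^sub>0) > 0"
  shows "oP1 M (\<lambda>n \<omega>. sqrt (real n) * (b_ad G\<^sub>0 n (\<theta>_hat n \<omega>) (\<lambda>i. X i \<omega>) - b_ls G\<^sub>0 P \<theta>\<^sub>0)
                   - (1 / sqrt (real n)) * (\<Sum>i<n. IF_ad G\<^sub>0 P \<theta>\<^sub>0 \<psi> (X i \<omega>)))
    \<and> weak_conv_m
        (\<lambda>n. distr M borel
               (\<lambda>\<omega>. sqrt (real n) * (b_ad G\<^sub>0 n (\<theta>_hat n \<omega>) (\<lambda>i. X i \<omega>) - b_ls G\<^sub>0 P \<theta>\<^sub>0)))
        (normal_law 0 (\<integral>x. (IF_ad G\<^sub>0 P \<theta>\<^sub>0 \<psi> x)\<^sup>2 \<partial>P))"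
proof -
  interpret prob_space M by (rule prob)
  interpret location_scale_sample M X P G\<^sub>0 \<theta>\<^sub>0
    using X_rv X_indep X_law G0_cont G0_mono G0_bij \<theta>0_param G_L2_diff by unfold_locales auto
  \<comment> \<open>Measurability is part of the definition of \<open>conv_in_prob\<close>.\<close>
  have "\<theta>_hat n \<in> borel_measurable M" for n
    using \<theta>_hat_lim by (simp add: conv_in_prob_def)
  from b_ad_asymptotics[OF this \<psi>_meas \<psi>_sq \<psi>_mean \<theta>_hat_expansion m_diff G_diff G_deriv_pos]
  show ?thesis by blast
qed

end
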